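(* Let $n\ge 0$, let $G$ be a group of type $F_n$, let $M$ be a proper CAT(0) space, let $e\in\partial M$, and let $\rho:G\to\mathrm{Isom}(M,e)$ be an action of $G$ on $M$ by isometries fixing the point $e$. Let $\kappa\rho=\chi_{\rho,e}:G\to\mathbb R$ be the induced character, $\chi_{\rho,e}(g)=\beta_\gamma(ga)-\beta_\gamma(a)$ (for any $a\in M$ and any geodesic ray $\gamma$ with $\gamma(\infty)=e$). Then $e\in\Sigma^n(\rho)$ (or, equivalently, $e\in\mathop{\Sigma}\limits^{\circ}{}^n(\rho)$) if and only if $[\kappa\rho]\in\Sigma^n(G)$ (meaning in particular $\kappa\rho\ne 0$).
   Context: $\partial M$ is the set of asymptoty classes $e=\gamma(\infty)$ of geodesic rays $\gamma:[0,\infty)\to M$ (isometric embeddings; two rays are asymptotic if $d(\gamma(t),\gamma'(t))$ is bounded), with the cone topology (identify $\partial M$ with the rays from a fixed base point, with the compact-open topology). $\mathrm{Isom}(M,e)$ is the group of isometries of $M$ whose induced map on $\partial M$ fixes $e$. Busemann functions and horoballs: $\beta_\gamma(b)=\lim_{t\to\infty}\bigl(t-d(b,\gamma(t))\bigr)$, $HB_s(\gamma)=\beta_\gamma^{-1}([s,\infty))$, $s\in\mathbb R$. For $g$ fixing $e$ the number $\beta_\gamma(ga)-\beta_\gamma(a)$ does not depend on $a$ or on $\gamma$, and $\chi_{\rho,e}$ is an additive homomorphism. Controlled connectivity: for an isometric action $\rho$ of $G$ on a proper CAT(0) space $M$ choose a free contractible $G$-CW-complex $X$ with $G\backslash X^n$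 finite and a continuous $G$-map $h:X\to M$; $X_{(\gamma,s)}$ denotes the largest subcomplex of $X$ lying in $h^{-1}(HB_s(\gamma))$. With $e=\gamma(\infty)$, $\rho$ is $CC^{n-1}$ over $e$ if for every $s\in\mathbb R$ and every $-1\le p\le n-1$ there is $\lambda\ge 0$ such that every map $S^p\to X_{(\gamma,s)}$ extends to a map $B^{p+1}\to X_{(\gamma,s-\lambda)}$ (for $p=-1$: every $X_{(\gamma,s)}$ is non-empty). This does not depend on the choices of $\gamma$, $X$, $h$. Put $\Sigma^n(\rho)=\{e\in\partial M\mid \rho \text{ is } CC^{n-1}\text{ over } e\}$ and $\mathop{\Sigma}\limits^{\circ}{}^n(\rho)=\{e\in\partial M\mid \mathrm{cl}_{\partial M}(Ge)\subseteq\Sigma^n(\rho)\}$. $S(G)$ is the set of non-zero additive characters $\chi:G\to\mathbb R$ modulo positive scalar multiplication, $[\chi]$ the class of $\chi$. A character $\chi$ is regarded as an action of $G$ on the Euclidean line $\mathbb R$ by translations $g\cdot r=r+\chi(g)$, and $\infty\in\partial\mathbb R$ is the endpoint of the ray $t\mapsto t$. Put $\Sigma^n(G)=\{[\chi]\in S(G)\mid\chi\text{ is }CC^{n-1}\text{ over }\infty\}$. *)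

theory Defs
  imports "HOL-Analysis.Analysis" "HOL-Algebra.Group_Action"
begin

section \<open>Proper CAT(0) spaces and their boundary\<close>

definition proper_space :: "'m::metric_space itself \<Rightarrow> bool" where
  "proper_space _ \<longleftrightarrow> (\<forall>(x::'m) r. compact (cball x r))"

definition geodesic :: "'m::metric_space \<Rightarrow> 'm \<Rightarrow> (real \<Rightarrow> 'm) \<Rightarrow> bool" where
  "geodesic x y c \<longleftrightarrow> c 0 = x \<and> c (dist x y) = y \<and>
     (\<forall>s\<in>{0..dist x y}. \<forall>t\<in>{0..dist x y}. dist (c s) (c t) = \<bar>s - t\<bar>)"

text \<open>Two points of a geodesic triangle always lie on two sides with a common vertex. As the
  vertices \<open>p\<close>, \<open>q\<close>, \<open>r\<close> and the sides are arbitrary, it suffices to compare points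
  on the sides issuing from \<open>p\<close>; \<open>x'\<close> and \<open>y'\<close> are their comparison points in the
  comparison triangle \<open>p'\<close>, \<open>q'\<close>, \<open>r'\<close>.\<close>

definition CAT0 :: "'m::metric_space itself \<Rightarrow> bool" where
  "CAT0 _ \<longleftrightarrow>
     (\<forall>x y::'m. \<exists>c. geodesic x y c) \<and>
     (\<forall>(p::'m) q r c c'. geodesic p q c \<longrightarrow> geodesic p r c' \<longrightarrow>
        (\<forall>(p'::real^2) q' r'.
           dist p' q' = dist p q \<longrightarrow> dist p' r' = dist p r \<longrightarrow> dist q' r' = dist q r \<longrightarrow>
           (\<forall>s\<in>{0..dist p q}. \<forall>t\<in>{0..dist p r}.
              \<forall>x'\<in>closed_segment p' q'. \<forall>y'\<in>closed_segment p' r'.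
                dist p' x' = s \<longrightarrow> dist p' y' = t \<longrightarrow> dist (c s) (c' t) \<le> dist x' y')))"

text \<open>Rays are total functions on the reals of which only the restriction to \<open>{0..}\<close> matters:
  functions that agree on \<open>{0..}\<close> are asymptotic.\<close>

definition geodesic_ray :: "(real \<Rightarrow> 'm::metric_space) \<Rightarrow> bool" where
  "geodesic_ray \<gamma> \<longleftrightarrow> (\<forall>s\<ge>0. \<forall>t\<ge>0. dist (\<gamma> s) (\<gamma> t) = \<bar>s - t\<bar>)"

definition asymptotic :: "(real \<Rightarrow> 'm::metric_space) \<Rightarrow> (real \<Rightarrow> 'm) \<Rightarrow> bool" where
  "asymptotic \<gamma> \<gamma>' \<longleftrightarrow> (\<exists>C. \<forall>t\<ge>0. dist (\<gamma> t) (\<gamma>' t) \<le> C)"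

definition endpoint :: "(real \<Rightarrow> 'm::metric_space) \<Rightarrow> (real \<Rightarrow> 'm) set" where
  "endpoint \<gamma> = {\<gamma>'. geodesic_ray \<gamma>' \<and> asymptotic \<gamma> \<gamma>'}"

definition boundary :: "(real \<Rightarrow> 'm::metric_space) set set" where
  "boundary = {endpoint \<gamma> |\<gamma>. geodesic_ray \<gamma>}"

definition boundary_map :: "('m::metric_space \<Rightarrow> 'm) \<Rightarrow> (real \<Rightarrow> 'm) set \<Rightarrow> (real \<Rightarrow> 'm) set" where
  "boundary_map f e = (\<lambda>\<gamma>. f \<circ> \<gamma>) ` e"

text \<open>The compact-open topology on the rays from the base point \<open>b\<close>, transported to the
  boundary.\<close>

definition cone_topology :: "'m::metric_space \<Rightarrow> (real \<Rightarrow> 'm) set topology" where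
  "cone_topology b = topology_generated_by
     {{e \<in> boundary. \<exists>\<gamma>\<in>e. \<gamma> 0 = b \<and> \<gamma> ` K \<subseteq> U} |K U. K \<subseteq> {0..} \<and> compact K \<and> open U}"

definition busemann :: "(real \<Rightarrow> 'm::metric_space) \<Rightarrow> 'm \<Rightarrow> real" where
  "busemann \<gamma> b = Lim at_top (\<lambda>t. t - dist b (\<gamma> t))"

definition horoball :: "(real \<Rightarrow> 'm::metric_space) \<Rightarrow> real \<Rightarrow> 'm set" where
  "horoball \<gamma> s = busemann \<gamma> -` {s..}"

definition isometric_action ::
  "('g, 'b) monoid_scheme \<Rightarrow> ('g \<Rightarrow> 'm::metric_space \<Rightarrow> 'm) \<Rightarrow> bool" where
  "isometric_action G \<rho> \<longleftrightarrow> group_action G UNIV \<rho> \<and>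
     (\<forall>g\<in>carrier G. \<forall>x y. dist (\<rho> g x) (\<rho> g y) = dist x y)"

definition induced_character ::
  "('g \<Rightarrow> 'm::metric_space \<Rightarrow> 'm) \<Rightarrow> (real \<Rightarrow> 'm) set \<Rightarrow> 'g \<Rightarrow> real" where
  "induced_character \<rho> e g = (THE r. \<forall>\<gamma>\<in>e. \<forall>a. busemann \<gamma> (\<rho> g a) - busemann \<gamma> a = r)"

section \<open>CW complexes with a group action\<close>

definition disc :: "nat \<Rightarrow> (nat \<Rightarrow> real) topology" where
  "disc n = subtopology (Euclidean_space n) {x. (\<Sum>i<n. (x i)\<^sup>2) \<le> 1}"

text \<open>\<open>cells n\<close> is the set of open \<open>n\<close>-cells. The conditions are: Hausdorff; partition into
  cells; characteristic maps, with the boundary of a cell in finitely many cells of lower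
  dimension; weak topology.\<close>

definition cw_complex :: "'x topology \<Rightarrow> (nat \<Rightarrow> 'x set set) \<Rightarrow> bool" where
  "cw_complex X cells \<longleftrightarrow>
     Hausdorff_space X \<and>
     topspace X = (\<Union>n. \<Union>(cells n)) \<and>
     (\<forall>m n. \<forall>c\<in>cells m. \<forall>d\<in>cells n. (m, c) \<noteq> (n, d) \<longrightarrow> disjnt c d) \<and>
     (\<forall>n. \<forall>c\<in>cells n. \<exists>\<Phi>.
        continuous_map (disc n) X \<Phi> \<and>
        homeomorphic_map (subtopology (disc n) {x. (\<Sum>i<n. (x i)\<^sup>2) < 1}) (subtopology X c) \<Phi> \<and>
        (\<exists>F. finite F \<and> F \<subseteq> (\<Union>m<n. cells m) \<and>
           \<Phi> ` {x \<in> topspace (disc n). (\<Sum>i<n. (x i)\<^sup>2) = 1} \<subseteq> \<Union>F)) \<and>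
     (\<forall>A\<subseteq>topspace X. (\<forall>n. \<forall>c\<in>cells n. closedin X (A \<inter> X closure_of c)) \<longrightarrow> closedin X A)"

definition subcomplex :: "'x topology \<Rightarrow> (nat \<Rightarrow> 'x set set) \<Rightarrow> 'x set \<Rightarrow> bool" where
  "subcomplex X cells A \<longleftrightarrow>
     (\<exists>F. F \<subseteq> (\<Union>n. cells n) \<and> A = \<Union>F \<and> (\<forall>c\<in>F. X closure_of c \<subseteq> A))"

definition largest_subcomplex :: "'x topology \<Rightarrow> (nat \<Rightarrow> 'x set set) \<Rightarrow> 'x set \<Rightarrow> 'x set" where
  "largest_subcomplex X cells S = \<Union>{A. subcomplex X cells A \<and> A \<subseteq> S}"

text \<open>An element of \<open>G\<close> that maps a cell to itself has to fix it pointwise. For the discrete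
  group \<open>G\<close> this is the same as building \<open>X\<close> by attaching equivariant cells
  \<open>G/H \<times> D\<^sup>n\<close>.\<close>

definition G_cw_complex ::
  "('g, 'b) monoid_scheme \<Rightarrow> 'x topology \<Rightarrow> (nat \<Rightarrow> 'x set set) \<Rightarrow> ('g \<Rightarrow> 'x \<Rightarrow> 'x) \<Rightarrow> bool" where
  "G_cw_complex G X cells \<alpha> \<longleftrightarrow>
     cw_complex X cells \<and>
     group_action G (topspace X) \<alpha> \<and>
     (\<forall>g\<in>carrier G. continuous_map X X (\<alpha> g)) \<and>
     (\<forall>g\<in>carrier G. \<forall>n. \<forall>c\<in>cells n.
        \<alpha> g ` c \<in> cells n \<and> (\<alpha> g ` c = c \<longrightarrow> (\<forall>x\<in>c. \<alpha> g x = x)))"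

definition free_action :: "('g, 'b) monoid_scheme \<Rightarrow> 'x set \<Rightarrow> ('g \<Rightarrow> 'x \<Rightarrow> 'x) \<Rightarrow> bool" where
  "free_action G E \<alpha> \<longleftrightarrow> (\<forall>x\<in>E. stabilizer G \<alpha> x = {\<one>\<^bsub>G\<^esub>})"

text \<open>A free contractible \<open>G\<close>-CW-complex with finite \<open>G\<close>-quotient of its \<open>n\<close>-skeleton. The
  library counts the empty space as contractible, so it has to be excluded.\<close>

definition F_complex ::
  "nat \<Rightarrow> ('g, 'b) monoid_scheme \<Rightarrow> 'x topology \<Rightarrow> (nat \<Rightarrow> 'x set set) \<Rightarrow> ('g \<Rightarrow> 'x \<Rightarrow> 'x) \<Rightarrow> bool"
where
  "F_complex n G X cells \<alpha> \<longleftrightarrow>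
     G_cw_complex G X cells \<alpha> \<and> free_action G (topspace X) \<alpha> \<and>
     topspace X \<noteq> {} \<and> contractible_space X \<and>
     (\<forall>m\<le>n. finite (orbits G (cells m) (\<lambda>g c. \<alpha> g ` c)))"

text \<open>The type argument is the universe from which the points of the complexes are taken.
  Under the hypothesis \<open>type_F\<close> it is large enough for the complexes used below to exist.\<close>

definition type_F :: "'x itself \<Rightarrow> nat \<Rightarrow> ('g, 'b) monoid_scheme \<Rightarrow> bool" where
  "type_F _ n G \<longleftrightarrow> (\<exists>(X::'x topology) cells \<alpha>. F_complex n G X cells \<alpha>)"

section \<open>Controlled connectivity\<close>

text \<open>The sphere \<open>nsphere p\<close> is the boundary of \<open>disc (Suc p)\<close>. The predicate \<open>CC _ n\<close>
  is the property \<open>CC\<close> with upper index \<open>n - 1\<close>: the non-emptiness clause is the case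
  \<open>p = -1\<close>, and \<open>p < n\<close> covers the cases from \<open>0\<close> to \<open>n - 1\<close>. The property does
  not depend on the choice of the complex, of \<open>h\<close> and of \<open>\<gamma>\<close>; it is required for one choice.\<close>

definition CC ::
  "'x itself \<Rightarrow> nat \<Rightarrow> ('g, 'b) monoid_scheme \<Rightarrow> ('g \<Rightarrow> 'm::metric_space \<Rightarrow> 'm)
     \<Rightarrow> (real \<Rightarrow> 'm) set \<Rightarrow> bool" where
  "CC _ n G \<rho> e \<longleftrightarrow>
     (\<exists>(X::'x topology) cells \<alpha> h \<gamma>.
        F_complex n G X cells \<alpha> \<and>
        continuous_map X euclidean h \<and>
        (\<forall>g\<in>carrier G. \<forall>x\<in>topspace X. h (\<alpha> g x) = \<rho> g (h x)) \<and>
        \<gamma> \<in> e \<and>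
        (let X\<gamma> = (\<lambda>s. largest_subcomplex X cells (h -` horoball \<gamma> s \<inter> topspace X)) in
          (\<forall>s. X\<gamma> s \<noteq> {}) \<and>
          (\<forall>s. \<forall>p<n. \<exists>l\<ge>0. \<forall>f.
             continuous_map (nsphere p) (subtopology X (X\<gamma> s)) f \<longrightarrow>
             (\<exists>F. continuous_map (disc (Suc p)) (subtopology X (X\<gamma> (s - l))) F \<and>
                  (\<forall>x\<in>topspace (nsphere p). F x = f x)))))"

definition Sigma_action ::
  "'x itself \<Rightarrow> nat \<Rightarrow> ('g, 'b) monoid_scheme \<Rightarrow> ('g \<Rightarrow> 'm::metric_space \<Rightarrow> 'm)
     \<Rightarrow> (real \<Rightarrow> 'm) set set" where
  "Sigma_action U n G \<rho> = {e \<in> boundary. CC U n G \<rho> e}"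

definition Sigma_action_circ ::
  "'x itself \<Rightarrow> 'm \<Rightarrow> nat \<Rightarrow> ('g, 'b) monoid_scheme \<Rightarrow> ('g \<Rightarrow> 'm::metric_space \<Rightarrow> 'm)
     \<Rightarrow> (real \<Rightarrow> 'm) set set" where
  "Sigma_action_circ U b n G \<rho> =
     {e \<in> boundary.
        cone_topology b closure_of (orbit G (\<lambda>g. boundary_map (\<rho> g)) e) \<subseteq> Sigma_action U n G \<rho>}"

section \<open>Characters\<close>

definition nonzero_characters :: "('g, 'b) monoid_scheme \<Rightarrow> ('g \<Rightarrow> real) set" where
  "nonzero_characters G =
     {\<psi>. (\<forall>x\<in>carrier G. \<forall>y\<in>carrier G. \<psi> (x \<otimes>\<^bsub>G\<^esub> y) = \<psi> x + \<psi> y) \<and> (\<exists>x\<in>carrier G. \<psi> x \<noteq> 0)}"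

text \<open>Only the values on \<open>carrier G\<close> matter. The class of a function that is not a non-zero
  character is empty, hence not an element of \<open>character_sphere\<close>.\<close>

definition character_class :: "('g, 'b) monoid_scheme \<Rightarrow> ('g \<Rightarrow> real) \<Rightarrow> ('g \<Rightarrow> real) set" where
  "character_class G \<psi> =
     {\<psi>' \<in> nonzero_characters G. \<exists>r>0. \<forall>x\<in>carrier G. \<psi>' x = r * \<psi> x}"

definition character_sphere :: "('g, 'b) monoid_scheme \<Rightarrow> ('g \<Rightarrow> real) set set" where
  "character_sphere G = character_class G ` nonzero_characters G"

definition Sigma_group ::
  "'x itself \<Rightarrow> nat \<Rightarrow> ('g, 'b) monoid_scheme \<Rightarrow> ('g \<Rightarrow> real) set set" where
  "Sigma_group U n G =
     {C \<in> character_sphere G. \<exists>\<psi>\<in>C. CC U n G (\<lambda>g r. r + \<psi> g) (endpoint (\<lambda>t. t))}"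

end

(* Let beta be the Busemann function of a ray towards e. If h : X -> M is a G-map, then beta o h : X -> R
   is a G-map for the character, and both maps have the same preimages of horoballs; this gives one
   direction. The character is not zero, because an invariant function is bounded on the 0-cells.

   Conversely, let h' : X -> R be a G-map for the character, up to a positive factor. A G-map h : X -> M is
   constructed cell by cell such that beta o h >= h' and such that the minimum of h' over a closed cell is
   attained at a point where beta o h = h', or else in a cell of lower dimension. Then a subcomplex lies in
   {beta o h >= s} if and only if it lies in {h' >= s}. To extend h over a cell, cone its boundary values
   off to a point at the height of that minimum, and push the result towards a far point of the ray
   wherever it is too low. Beta takes the required values because the character is not zero. *)
theory Submission
  imports Defs
begin

section \<open>CAT(0) inequalities\<close>

text \<open>The heights under any two G-maps with the same character differ by a
  \<open>G\<close>-invariant function. It is bounded on the \<open>n\<close>-skeleton, but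
  \<open>X\<close> may have infinitely many orbits of cells above it, and a comparison up to a
  bounded shift would call for cellular approximation. The subcomplexes for the given
  \<open>X\<close> are therefore made equal on the nose. Equal heights at every point are out of
  reach in general: this would mean extending maps inside horospheres, which can be disconnected, as
  in a tree. Horoballs are convex, so heights can be raised along geodesics. It is enough that the
  minimum over each closed cell is exact, because a subcomplex contains the closure of each of its
  cells. The metric estimates come from one quadratic inequality,
  \<open>CAT0_dist_square_le\<close>. Properness enters through completeness, which provides a ray
  from the base point of the cone topology in each class.\<close>

lemma comparison_triangle:
  fixes u v w :: real
  assumes "0 \<le> u" "0 \<le> v" "u \<le> v + w" "v \<le> u + w" "w \<le> u + v"
  obtains q r :: "real^2" where "norm q = u" "norm r = v" "norm (q - r) = w"
proof (cases "u = 0")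
  case True
  then have "w = v" using assms by linarith
  moreover have "norm (vector [v, 0] :: real^2) = v" using assms(2)
    by (simp add: norm_vec_def L2_set_def sum_2)
  ultimately show ?thesis using that[of 0 "vector [v, 0]"] True by simp
next
  case False
  then have u: "u > 0" using assms by simp
  \<comment> \<open>The law of cosines prescribes the first coordinate of \<open>r\<close>. The
    triangle inequalities give \<open>\<bar>x\<bar> \<le> v\<close>, so the square root below is
    real.\<close>
  define x where "x = (u\<^sup>2 + v\<^sup>2 - w\<^sup>2) / (2*u)"
  have w0: "w \<ge> 0" using assms by linarith
  have ux: "2 * u * x = u\<^sup>2 + v\<^sup>2 - w\<^sup>2" using u by (simp add: x_def)
  have "(u - v)\<^sup>2 \<le> w\<^sup>2" using assms w0 by (intro abs_le_square_iff[THEN iffD1]) auto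
  moreover have "w\<^sup>2 \<le> (u + v)\<^sup>2" using assms w0 by (intro power_mono) auto
  ultimately have "2 * u * x \<le> 2 * u * v" "2 * u * (-v) \<le> 2 * u * x"
    unfolding ux by (auto simp: power2_eq_square algebra_simps)
  then have "x \<le> v" "-v \<le> x" using u
    by (metis mult_le_cancel_left_pos mult_pos_pos zero_less_numeral)+
  then have xv: "x\<^sup>2 \<le> v\<^sup>2" by (intro abs_le_square_iff[THEN iffD1]) auto
  let ?q = "vector [u, 0] :: real^2" and ?r = "vector [x, sqrt (v\<^sup>2 - x\<^sup>2)] :: real^2"
  have 1: "norm ?q = u" using u by (simp add: norm_vec_def L2_set_def sum_2)
  have 2: "norm ?r = v" using xv assms(2) by (simp add: norm_vec_def L2_set_def sum_2)
  have "(u - x)\<^sup>2 + (v\<^sup>2 - x\<^sup>2) = w\<^sup>2" using ux by (simp add: power2_eq_square algebra_simps)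
  then have "norm (?q - ?r) = w" using xv w0
    by (simp add: norm_vec_def L2_set_def sum_2)
  with 1 2 show ?thesis using that by blast
qed

text \<open>The law of cosines in the comparison triangle; the cosine is eliminated, so that degenerate
  triangles need no special treatment.\<close>

lemma CAT0_dist_square_le:
  fixes p :: "'m::metric_space"
  assumes "CAT0 TYPE('m)" "geodesic p q c" "geodesic p r c'" "0 \<le> l" "l \<le> 1" "0 \<le> m" "m \<le> 1"
  shows "(dist (c (l * dist p q)) (c' (m * dist p r)))\<^sup>2 \<le>
     l\<^sup>2 * (dist p q)\<^sup>2 + m\<^sup>2 * (dist p r)\<^sup>2 - l * m * ((dist p q)\<^sup>2 + (dist p r)\<^sup>2 - (dist q r)\<^sup>2)"
proof -
  let ?u = "dist p q" and ?v = "dist p r" and ?w = "dist q r"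
  have t: "?u \<le> ?v + ?w" "?v \<le> ?u + ?w" "?w \<le> ?u + ?v"
    by (rule dist_triangle2 dist_triangle dist_triangle3)+
  from comparison_triangle[OF zero_le_dist zero_le_dist t]
  obtain q' r' :: "real^2" where q: "norm q' = ?u" and r: "norm r' = ?v" and qr: "norm (q' - r') = ?w" .
  have "dist (c (l * ?u)) (c' (m * ?v)) \<le> dist (l *\<^sub>R q') (m *\<^sub>R r')"
  proof -
    have D: "dist 0 q' = ?u" "dist 0 r' = ?v" "dist q' r' = ?w"
      using q r qr by (simp_all add: dist_norm)
    note A = assms(1)[unfolded CAT0_def, THEN conjunct2, rule_format, OF assms(2,3) D]
    show ?thesis
    proof (rule A)
      show "l * ?u \<in> {0..?u}" "m * ?v \<in> {0..?v}"
        using assms(4-7) by (auto simp: mult_left_le_one_le)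
      show "l *\<^sub>R q' \<in> closed_segment 0 q'" "m *\<^sub>R r' \<in> closed_segment 0 r'"
        using assms(4-7) by (auto simp: closed_segment_def)
    qed (use assms(4-7) q r in auto)
  qed
  then have "(dist (c (l * ?u)) (c' (m * ?v)))\<^sup>2 \<le> (norm (l *\<^sub>R q' - m *\<^sub>R r'))\<^sup>2"
    by (simp add: dist_norm power_mono)
  also have "\<dots> = l\<^sup>2 * (norm q')\<^sup>2 + m\<^sup>2 * (norm r')\<^sup>2 - l * m * ((norm q')\<^sup>2 + (norm r')\<^sup>2 - (norm (q' - r'))\<^sup>2)"
    unfolding power2_norm_eq_inner
    by (simp add: inner_diff inner_commute algebra_simps power2_eq_square)
  finally show ?thesis unfolding q r qr .
qed

section \<open>Geodesics, geodesic combings and convexity of the metric\<close>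

lemma geodesic_start: "geodesic x y c \<Longrightarrow> c 0 = x"
  and geodesic_end: "geodesic x y c \<Longrightarrow> c (dist x y) = y"
  and geodesic_dist: "geodesic x y c \<Longrightarrow> s \<in> {0..dist x y} \<Longrightarrow> t \<in> {0..dist x y} \<Longrightarrow> dist (c s) (c t) = \<bar>s - t\<bar>"
  by (auto simp: geodesic_def)

lemma geodesic_reverse:
  assumes "geodesic x y c"
  shows "geodesic y x (\<lambda>t. c (dist x y - t))"
  using assms unfolding geodesic_def by (auto simp: dist_commute)

text \<open>Constant speed on the unit interval keeps the endpoints at times 0 and 1 while
  \<open>p\<close> varies. The geodesic is an arbitrary choice, but by \<open>dist_comb_le\<close>
  the result is Lipschitz in \<open>p\<close>.\<close>

definition comb :: "'m::metric_space \<Rightarrow> 'm \<Rightarrow> real \<Rightarrow> 'm" where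
  "comb q p t = (SOME c. geodesic q p c) (t * dist q p)"

lemma comb_geodesic:
  assumes "CAT0 TYPE('m::metric_space)"
  obtains c where "geodesic q (p::'m) c" "\<And>t. comb q p t = c (t * dist q p)"
proof -
  have "\<exists>c. geodesic q p c" using assms by (auto simp: CAT0_def)
  then have "geodesic q p (SOME c. geodesic q p c)" by (rule someI_ex)
  then show ?thesis using that unfolding comb_def by blast
qed

lemma comb_0: "CAT0 TYPE('m::metric_space) \<Longrightarrow> comb q (p::'m) 0 = q"
  by (rule comb_geodesic[of q p]) (auto dest: geodesic_start)

lemma comb_1: "CAT0 TYPE('m::metric_space) \<Longrightarrow> comb q (p::'m) 1 = p"
  by (rule comb_geodesic[of q p]) (auto dest: geodesic_end)

lemma dist_comb_same:
  assumes "CAT0 TYPE('m::metric_space)" "0 \<le> s" "s \<le> 1" "0 \<le> t" "t \<le> 1"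
  shows "dist (comb q (p::'m) s) (comb q p t) = \<bar>s - t\<bar> * dist q p"
proof (rule comb_geodesic[OF assms(1), of q p])
  fix c assume c: "geodesic q p c" "\<And>t. comb q p t = c (t * dist q p)"
  have "dist (c (s * dist q p)) (c (t * dist q p)) = \<bar>s * dist q p - t * dist q p\<bar>"
    using assms(2-) by (intro geodesic_dist[OF c(1)]) (auto simp: mult_left_le_one_le)
  then show ?thesis by (simp add: c(2) abs_mult flip: left_diff_distrib)
qed

text \<open>With equal ratios \<open>l = m\<close> the bound of \<open>CAT0_dist_square_le\<close>
  collapses to a square.\<close>

lemma geodesic_thin:
  fixes p :: "'m::metric_space"
  assumes "CAT0 TYPE('m)" "geodesic p q c" "geodesic p r c'" "0 \<le> l" "l \<le> 1"
  shows "dist (c (l * dist p q)) (c' (l * dist p r)) \<le> l * dist q r"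
proof -
  have "(dist (c (l * dist p q)) (c' (l * dist p r)))\<^sup>2 \<le> (l * dist q r)\<^sup>2"
    using CAT0_dist_square_le[OF assms(1-5,4,5)] by (simp add: power2_eq_square algebra_simps)
  then show ?thesis by (rule power2_le_imp_le) (use assms(4) in simp)
qed

lemma dist_comb_le:
  assumes "CAT0 TYPE('m::metric_space)" "0 \<le> t" "t \<le> 1"
  shows "dist (comb q (p::'m) t) (comb q p' t) \<le> t * dist p p'"
proof (rule comb_geodesic[OF assms(1), of q p], rule comb_geodesic[OF assms(1), of q p'])
  fix c c' assume "geodesic q p c" "\<And>t. comb q p t = c (t * dist q p)"
   and "geodesic q p' c'" "\<And>t. comb q p' t = c' (t * dist q p')"
  then show ?thesis using geodesic_thin[of q p c p' c' t] assms by simp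
qed

text \<open>This is the case \<open>m = 1\<close> of \<open>CAT0_dist_square_le\<close>. For
  \<open>t = 1/2\<close> it is the Bruhat-Tits inequality for midpoints.\<close>

lemma dist_comb_square_le:
  assumes "CAT0 TYPE('m::metric_space)" "0 \<le> t" "t \<le> 1"
  shows "(dist (comb q (p::'m) t) r)\<^sup>2 \<le>
    (1 - t) * (dist q r)\<^sup>2 + t * (dist p r)\<^sup>2 - t * (1 - t) * (dist q p)\<^sup>2"
proof (rule comb_geodesic[OF assms(1), of q p], rule comb_geodesic[OF assms(1), of q r])
  fix c c' assume c: "geodesic q p c" "\<And>t. comb q p t = c (t * dist q p)"
   and "geodesic q r c'"
  from CAT0_dist_square_le[OF assms(1) c(1) this(3) assms(2,3), of 1] this(3)
  have "(dist (comb q p t) r)\<^sup>2 \<le> t\<^sup>2 * (dist q p)\<^sup>2 + (dist q r)\<^sup>2 - t * ((dist q p)\<^sup>2 + (dist q r)\<^sup>2 - (dist p r)\<^sup>2)"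
    by (simp add: c(2) geodesic_end)
  then show ?thesis by (simp add: power2_eq_square algebra_simps)
qed

text \<open>Replacing \<open>dist q p\<close> by the smaller
  \<open>\<bar>dist q r - dist p r\<bar>\<close> turns the right-hand side of
  \<open>dist_comb_square_le\<close> into a perfect square.\<close>

lemma dist_comb_convex:
  assumes "CAT0 TYPE('m::metric_space)" "0 \<le> t" "t \<le> 1"
  shows "dist (comb q (p::'m) t) r \<le> (1 - t) * dist q r + t * dist p r"
proof -
  have "\<bar>dist q r - dist p r\<bar> \<le> dist q p"
    using dist_triangle[of q r p] dist_triangle3[of p r q] by (simp add: abs_le_iff)
  then have "(dist q r - dist p r)\<^sup>2 \<le> (dist q p)\<^sup>2"
    using abs_le_square_iff by fastforce
  then have "t * (1 - t) * (dist q r - dist p r)\<^sup>2 \<le> t * (1 - t) * (dist q p)\<^sup>2"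
    using assms by (intro mult_left_mono) auto
  with dist_comb_square_le[OF assms, of q p r]
  have "(dist (comb q p t) r)\<^sup>2 \<le> ((1 - t) * dist q r + t * dist p r)\<^sup>2"
    by (simp add: power2_eq_square algebra_simps)
  then show ?thesis by (rule power2_le_imp_le) (use assms in auto)
qed

text \<open>Both \<open>y\<close> and \<open>p\<close> are compared with the midpoint of the
  diagonal from \<open>x\<close> to \<open>q\<close>. The two terms
  \<open>- (dist x q)\<^sup>2 / 4\<close>, doubled, bring the square of that diagonal to the
  left.\<close>

lemma quadrilateral_inequality:
  assumes "CAT0 TYPE('m::metric_space)"
  shows "(dist (x::'m) q)\<^sup>2 + (dist y p)\<^sup>2 \<le>
    (dist x y)\<^sup>2 + (dist y q)\<^sup>2 + (dist q p)\<^sup>2 + (dist p x)\<^sup>2"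
proof -
  let ?m = "comb x q (1/2)"
  have "(dist ?m y)\<^sup>2 \<le> (dist x y)\<^sup>2 / 2 + (dist q y)\<^sup>2 / 2 - (dist x q)\<^sup>2 / 4"
    using dist_comb_square_le[OF assms, of "1/2" x q y] by simp
  moreover have "(dist ?m p)\<^sup>2 \<le> (dist x p)\<^sup>2 / 2 + (dist q p)\<^sup>2 / 2 - (dist x q)\<^sup>2 / 4"
    using dist_comb_square_le[OF assms, of "1/2" x q p] by simp
  moreover have "(dist y p)\<^sup>2 \<le> 2 * (dist ?m y)\<^sup>2 + 2 * (dist ?m p)\<^sup>2"
  proof -
    have "dist y p \<le> dist ?m y + dist ?m p" by (rule dist_triangle3)
    then have "(dist y p)\<^sup>2 \<le> (dist ?m y + dist ?m p)\<^sup>2" by (simp add: power_mono)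
    also have "\<dots> \<le> 2 * (dist ?m y)\<^sup>2 + 2 * (dist ?m p)\<^sup>2"
      using sum_squares_ge_zero[of "dist ?m y - dist ?m p" 0] by (simp add: power2_eq_square algebra_simps)
    finally show ?thesis .
  qed
  ultimately show ?thesis by (simp add: dist_commute)
qed

lemma continuous_on_comb:
  fixes h :: "'a::topological_space \<Rightarrow> 'm::metric_space"
  assumes "CAT0 TYPE('m)" "continuous_on S h" "continuous_on S m" "\<And>z. z \<in> S \<Longrightarrow> 0 \<le> m z \<and> m z \<le> 1"
  shows "continuous_on S (\<lambda>z. comb q (h z) (m z))"
  unfolding continuous_on_def
proof
  fix x assume x: "x \<in> S"
  have h: "((\<lambda>z. dist (h z) (h x)) \<longlongrightarrow> 0) (at x within S)"
    using assms(2) x by (auto simp: continuous_on_def intro!: tendsto_eq_intros)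
  have m: "((\<lambda>z. \<bar>m z - m x\<bar>) \<longlongrightarrow> 0) (at x within S)"
    using assms(3) x by (auto simp: continuous_on_def intro!: tendsto_eq_intros)
  have "((\<lambda>z. dist (h z) (h x) + \<bar>m z - m x\<bar> * dist q (h x)) \<longlongrightarrow> 0) (at x within S)"
    using tendsto_add[OF h tendsto_mult[OF m tendsto_const[of "dist q (h x)"]]] by simp
  \<comment> \<open>First the endpoint moves at a fixed time, then the time at a fixed
    endpoint.\<close>
  moreover have "dist (comb q (h z) (m z)) (comb q (h x) (m x)) \<le>
      dist (h z) (h x) + \<bar>m z - m x\<bar> * dist q (h x)" if z: "z \<in> S" for z
  proof -
    have "dist (comb q (h z) (m z)) (comb q (h x) (m z)) \<le> m z * dist (h z) (h x)"
      using assms(4)[OF z] by (intro dist_comb_le[OF assms(1)]) auto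
    also have "\<dots> \<le> dist (h z) (h x)"
      using assms(4)[OF z] by (simp add: mult_left_le_one_le)
    finally show ?thesis
      using dist_comb_same[OF assms(1), of "m z" "m x" q "h x"] assms(4)[OF z] assms(4)[OF x]
        dist_triangle[of "comb q (h z) (m z)" "comb q (h x) (m x)" "comb q (h x) (m z)"] by linarith
  qed
  then have "eventually (\<lambda>z. norm (dist (comb q (h z) (m z)) (comb q (h x) (m x))) \<le>
      dist (h z) (h x) + \<bar>m z - m x\<bar> * dist q (h x)) (at x within S)"
    by (simp add: eventually_at_filter)
  ultimately have "((\<lambda>z. dist (comb q (h z) (m z)) (comb q (h x) (m x))) \<longlongrightarrow> 0) (at x within S)"
    by (rule Lim_null_comparison[rotated])
  then show "((\<lambda>z. comb q (h z) (m z)) \<longlongrightarrow> comb q (h x) (m x)) (at x within S)"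
    using tendsto_dist_iff by blast
qed

section \<open>Busemann functions\<close>

lemma geodesic_rayD: "geodesic_ray \<gamma> \<Longrightarrow> 0 \<le> s \<Longrightarrow> 0 \<le> t \<Longrightarrow> dist (\<gamma> s) (\<gamma> t) = \<bar>s - t\<bar>"
  by (simp add: geodesic_ray_def)

lemma geodesic_ray_segment:
  assumes "geodesic_ray \<gamma>" "0 \<le> T"
  shows "geodesic (\<gamma> 0) (\<gamma> T) \<gamma>" and "dist (\<gamma> 0) (\<gamma> T) = T"
  using assms by (auto simp: geodesic_def geodesic_ray_def)

lemma busemann_tendsto:
  assumes "geodesic_ray \<gamma>"
  shows "((\<lambda>t. t - dist x (\<gamma> t)) \<longlongrightarrow> busemann \<gamma> x) at_top"
proof -
  \<comment> \<open>Only times \<open>t \<ge> 0\<close> are controlled, so the function is frozen on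
    the negative axis. It is then monotone on the whole line, and its limit is its supremum.\<close>
  let ?f = "\<lambda>t. t - dist x (\<gamma> (max 0 t)) + (max 0 t - t)"
  have mono: "mono ?f"
  proof (rule monoI)
    fix s t :: real assume "s \<le> t"
    moreover have "dist (\<gamma> (max 0 s)) (\<gamma> (max 0 t)) = \<bar>max 0 s - max 0 t\<bar>"
      using assms by (simp add: geodesic_rayD)
    moreover have "dist x (\<gamma> (max 0 t)) \<le> dist x (\<gamma> (max 0 s)) + dist (\<gamma> (max 0 s)) (\<gamma> (max 0 t))"
      by (rule dist_triangle)
    ultimately show "?f s \<le> ?f t" by linarith
  qed
  have bdd: "?f t \<le> dist x (\<gamma> 0)" for t
  proof -
    have "dist (\<gamma> 0) (\<gamma> (max 0 t)) = max 0 t" using assms by (simp add: geodesic_rayD)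
    moreover have "dist (\<gamma> 0) (\<gamma> (max 0 t)) \<le> dist x (\<gamma> 0) + dist x (\<gamma> (max 0 t))" by (rule dist_triangle3)
    ultimately show ?thesis by linarith
  qed
  obtain l where "(?f \<longlongrightarrow> l) at_top"
  proof -
    have "(?f \<longlongrightarrow> (SUP t. ?f t)) at_top"
    proof (rule increasing_tendsto)
      have B: "bdd_above (range ?f)" using bdd by (intro bdd_aboveI) blast
      then show "\<forall>\<^sub>F n in at_top. ?f n \<le> (SUP t. ?f t)"
        by (intro always_eventually allI cSUP_upper) auto
      fix y assume "y < (SUP t. ?f t)"
      then obtain T where T: "y < ?f T" using B less_cSUP_iff[of UNIV ?f y] by auto
      show "\<forall>\<^sub>F n in at_top. y < ?f n"
        using eventually_ge_at_top[of T] by eventually_elim (use T monoD[OF mono] less_le_trans in blast)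
    qed
    then show ?thesis using that by blast
  qed
  moreover have "\<forall>\<^sub>F t in at_top. ?f t = t - dist x (\<gamma> t)"
    using eventually_ge_at_top[of 0] by eventually_elim simp
  ultimately have "((\<lambda>t. t - dist x (\<gamma> t)) \<longlongrightarrow> l) at_top"
    by (simp add: tendsto_cong)
  then show ?thesis unfolding busemann_def by (metis tendsto_Lim trivial_limit_at_top_linorder)
qed

lemma busemann_eqI:
  "((\<lambda>t. t - dist x (\<gamma> t)) \<longlongrightarrow> l) at_top \<Longrightarrow> busemann \<gamma> x = l"
  unfolding busemann_def by (rule tendsto_Lim) simp_all

lemma busemann_ray: "geodesic_ray \<gamma> \<Longrightarrow> 0 \<le> s \<Longrightarrow> busemann \<gamma> (\<gamma> s) = s"
  by (intro busemann_eqI tendsto_eventually eventually_mono[OF eventually_ge_at_top[of s]])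
    (simp add: geodesic_rayD)

lemma busemann_Lipschitz:
  assumes "geodesic_ray \<gamma>"
  shows "\<bar>busemann \<gamma> x - busemann \<gamma> y\<bar> \<le> dist x y"
proof (rule tendsto_upperbound)
  show "((\<lambda>t. \<bar>(t - dist x (\<gamma> t)) - (t - dist y (\<gamma> t))\<bar>) \<longlongrightarrow> \<bar>busemann \<gamma> x - busemann \<gamma> y\<bar>) at_top"
    by (intro tendsto_intros busemann_tendsto assms)
  have "\<bar>(t - dist x (\<gamma> t)) - (t - dist y (\<gamma> t))\<bar> \<le> dist x y" for t
    using dist_triangle[of x "\<gamma> t" y] dist_triangle3[of y "\<gamma> t" x] by (simp add: abs_le_iff)
  then show "\<forall>\<^sub>F t in at_top. \<bar>(t - dist x (\<gamma> t)) - (t - dist y (\<gamma> t))\<bar> \<le> dist x y" by simp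
qed simp

lemma continuous_on_busemann: "geodesic_ray \<gamma> \<Longrightarrow> continuous_on S (busemann \<gamma>)"
  by (rule continuous_on_subset[OF lipschitz_on_continuous_on subset_UNIV], rule lipschitz_onI[of _ _ 1])
    (simp_all add: dist_real_def busemann_Lipschitz)

text \<open>Distances are convex along \<open>comb\<close>, and a Busemann function is a limit of
  negated distances up to constants.\<close>

lemma busemann_comb_concave:
  assumes "CAT0 TYPE('m::metric_space)" "geodesic_ray \<gamma>" "0 \<le> t" "t \<le> 1"
  shows "(1 - t) * busemann \<gamma> q + t * busemann \<gamma> (p::'m) \<le> busemann \<gamma> (comb q p t)"
proof (rule tendsto_le)
  show "((\<lambda>s. (1 - t) * (s - dist q (\<gamma> s)) + t * (s - dist p (\<gamma> s))) \<longlongrightarrow>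
      (1 - t) * busemann \<gamma> q + t * busemann \<gamma> p) at_top"
    by (intro tendsto_intros busemann_tendsto assms)
  show "((\<lambda>s. s - dist (comb q p t) (\<gamma> s)) \<longlongrightarrow> busemann \<gamma> (comb q p t)) at_top"
    by (intro busemann_tendsto assms)
  have "(1 - t) * (s - dist q (\<gamma> s)) + t * (s - dist p (\<gamma> s)) \<le> s - dist (comb q p t) (\<gamma> s)" for s
    using dist_comb_convex[OF assms(1,3,4), of q p "\<gamma> s"] by (simp add: algebra_simps)
  then show "\<forall>\<^sub>F s in at_top. (1 - t) * (s - dist q (\<gamma> s)) + t * (s - dist p (\<gamma> s)) \<le> s - dist (comb q p t) (\<gamma> s)"
    by simp
qed simp

text \<open>The height varies continuously on the way from \<open>q\<close> to a point of the ray at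
  height \<open>max 0 v\<close>; only non-negative parameters of \<open>\<gamma>\<close> are
  meaningful.\<close>

lemma busemann_surj:
  assumes "CAT0 TYPE('m::metric_space)" "geodesic_ray \<gamma>" "busemann \<gamma> (q::'m) \<le> v"
  shows "\<exists>p. busemann \<gamma> p = v"
proof -
  let ?P = "\<gamma> (max 0 v)"
  have "\<exists>t. 0 \<le> t \<and> t \<le> 1 \<and> busemann \<gamma> (comb q ?P t) = v"
  proof (rule IVT')
    show "busemann \<gamma> (comb q ?P 0) \<le> v" using assms by (simp add: comb_0)
    show "v \<le> busemann \<gamma> (comb q ?P 1)" using assms by (simp add: comb_1 busemann_ray)
    have "continuous_on {0..1} (\<lambda>t. comb q ?P t)"
      by (rule continuous_on_comb[OF assms(1)]) (auto intro: continuous_intros)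
    then show "continuous_on {0..1} (\<lambda>t. busemann \<gamma> (comb q ?P t))"
      using continuous_on_compose2[OF continuous_on_busemann[OF assms(2), of UNIV]] by blast
  qed simp
  then show ?thesis by blast
qed

text \<open>The quadrilateral inequality bounds the difference of the quantities
  \<open>d(y, \<gamma> t)\<^sup>2 - d(x, \<gamma> t)\<^sup>2\<close> and \<open>d(y, \<gamma>' t)\<^sup>2 - d(x, \<gamma>' t)\<^sup>2\<close>; divided by \<open>2 t\<close>,
  they converge to \<open>busemann \<gamma> x - busemann \<gamma> y\<close> and its analogue for \<open>\<gamma>'\<close>.\<close>

lemma busemann_asymptotic_le:
  assumes "CAT0 TYPE('m::metric_space)" "geodesic_ray \<gamma>" "geodesic_ray \<gamma>'" "asymptotic \<gamma> \<gamma>'"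
  shows "busemann \<gamma> (x::'m) - busemann \<gamma> y \<le> busemann \<gamma>' x - busemann \<gamma>' y"
proof -
  obtain C where C: "\<And>t. t \<ge> 0 \<Longrightarrow> dist (\<gamma> t) (\<gamma>' t) \<le> C" using assms(4) by (auto simp: asymptotic_def)
  have lim: "((\<lambda>t. ((dist y (\<gamma> t))\<^sup>2 - (dist x (\<gamma> t))\<^sup>2) / (2 * t)) \<longlongrightarrow> busemann \<gamma> x - busemann \<gamma> y) at_top"
    if "geodesic_ray \<gamma>" for \<gamma> :: "real \<Rightarrow> 'm"
  proof -
    have z: "((\<lambda>t. inverse (2 * t)) \<longlongrightarrow> (0::real)) at_top"
      by (intro tendsto_inverse_0_at_top filterlim_tendsto_pos_mult_at_top[OF tendsto_const]) (auto simp: filterlim_ident)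
    note B = busemann_tendsto[OF that]
    \<comment> \<open>With \<open>A = t - dist x (\<gamma> t)\<close> and
      \<open>B = t - dist y (\<gamma> t)\<close> the difference of squares is
      \<open>(A - B) * (2 * t - A - B)\<close>. After division by \<open>2 * t\<close> the second
      factor tends to 1.\<close>
    have "((\<lambda>t. ((t - dist x (\<gamma> t)) - (t - dist y (\<gamma> t))) *
        (1 - ((t - dist x (\<gamma> t)) + (t - dist y (\<gamma> t))) * inverse (2 * t))) \<longlongrightarrow>
        (busemann \<gamma> x - busemann \<gamma> y) * (1 - (busemann \<gamma> x + busemann \<gamma> y) * 0)) at_top"
      by (intro tendsto_intros B z)
    moreover have "\<forall>\<^sub>F t in at_top. ((t - dist x (\<gamma> t)) - (t - dist y (\<gamma> t))) *
        (1 - ((t - dist x (\<gamma> t)) + (t - dist y (\<gamma> t))) * inverse (2 * t)) =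
        ((dist y (\<gamma> t))\<^sup>2 - (dist x (\<gamma> t))\<^sup>2) / (2 * t)"
      using eventually_gt_at_top[of 0]
      by eventually_elim (simp add: field_simps power2_eq_square)
    ultimately show ?thesis by (simp add: tendsto_cong)
  qed
  have z: "((\<lambda>t. ((dist x y)\<^sup>2 + C\<^sup>2) / (2 * t)) \<longlongrightarrow> (0::real)) at_top"
    by (intro tendsto_divide_0[OF tendsto_const] filterlim_at_top_imp_at_infinity
        filterlim_tendsto_pos_mult_at_top[OF tendsto_const]) (auto simp: filterlim_ident)
  have "busemann \<gamma> x - busemann \<gamma> y \<le> (busemann \<gamma>' x - busemann \<gamma>' y) + 0"
  proof (rule tendsto_le)
    show "((\<lambda>t. ((dist y (\<gamma>' t))\<^sup>2 - (dist x (\<gamma>' t))\<^sup>2) / (2 * t) + ((dist x y)\<^sup>2 + C\<^sup>2) / (2 * t)) \<longlongrightarrow>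
      (busemann \<gamma>' x - busemann \<gamma>' y) + 0) at_top"
      by (intro tendsto_add lim assms z)
    show "((\<lambda>t. ((dist y (\<gamma> t))\<^sup>2 - (dist x (\<gamma> t))\<^sup>2) / (2 * t)) \<longlongrightarrow> busemann \<gamma> x - busemann \<gamma> y) at_top"
      by (intro lim assms)
    show "\<forall>\<^sub>F t in at_top. ((dist y (\<gamma> t))\<^sup>2 - (dist x (\<gamma> t))\<^sup>2) / (2 * t) \<le>
      ((dist y (\<gamma>' t))\<^sup>2 - (dist x (\<gamma>' t))\<^sup>2) / (2 * t) + ((dist x y)\<^sup>2 + C\<^sup>2) / (2 * t)"
      using eventually_gt_at_top[of 0]
    proof eventually_elim
      case (elim t)
      have "(dist (\<gamma>' t) (\<gamma> t))\<^sup>2 \<le> C\<^sup>2" using C[of t] elim by (intro power_mono) (auto simp: dist_commute)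
      \<comment> \<open>The diagonals of the quadrilateral join \<open>x\<close> to
        \<open>\<gamma>' t\<close> and \<open>y\<close> to \<open>\<gamma> t\<close>; its side
        between the two rays stays below \<open>C\<close>.\<close>
      then have "(dist y (\<gamma> t))\<^sup>2 - (dist x (\<gamma> t))\<^sup>2 \<le>
          (dist y (\<gamma>' t))\<^sup>2 - (dist x (\<gamma>' t))\<^sup>2 + ((dist x y)\<^sup>2 + C\<^sup>2)"
        using quadrilateral_inequality[OF assms(1), of x "\<gamma>' t" y "\<gamma> t"]
        by (simp add: dist_commute)
      then show ?case using elim by (simp add: divide_right_mono flip: add_divide_distrib)
    qed
  qed simp
  then show ?thesis by simp
qed

section \<open>Asymptoty classes of rays\<close>

lemma asymptotic_sym: "asymptotic \<gamma> \<gamma>' \<Longrightarrow> asymptotic \<gamma>' \<gamma>"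
  by (simp add: asymptotic_def dist_commute)

lemma asymptotic_trans: 
  assumes "asymptotic \<gamma> \<gamma>'" "asymptotic \<gamma>' \<gamma>''" shows "asymptotic \<gamma> \<gamma>''"
proof -
  obtain C D where C: "\<And>t. t \<ge> 0 \<Longrightarrow> dist (\<gamma> t) (\<gamma>' t) \<le> C" "\<And>t. t \<ge> 0 \<Longrightarrow> dist (\<gamma>' t) (\<gamma>'' t) \<le> D"
    using assms by (auto simp: asymptotic_def)
  have "dist (\<gamma> t) (\<gamma>'' t) \<le> C + D" if "t \<ge> 0" for t
    using C[OF that] dist_triangle[of "\<gamma> t" "\<gamma>'' t" "\<gamma>' t"] by linarith
  then show ?thesis by (auto simp: asymptotic_def)
qed

lemma boundaryD:
  assumes "e \<in> boundary" "\<gamma> \<in> e"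
  shows "geodesic_ray \<gamma>" and "e = endpoint \<gamma>"
proof -
  obtain \<gamma>0 where "e = endpoint \<gamma>0" "geodesic_ray \<gamma>0" using assms by (auto simp: boundary_def)
  then show "geodesic_ray \<gamma>" "e = endpoint \<gamma>"
    using assms(2) by (auto simp: endpoint_def intro: asymptotic_trans asymptotic_sym)
qed

lemma boundary_nonempty:
  assumes "e \<in> boundary" obtains \<gamma> where "\<gamma> \<in> e"
proof -
  obtain \<gamma>0 where "e = endpoint \<gamma>0" "geodesic_ray \<gamma>0" using assms by (auto simp: boundary_def)
  moreover have "asymptotic \<gamma>0 \<gamma>0" by (auto simp: asymptotic_def intro: exI[of _ 0])
  ultimately show ?thesis using that by (auto simp: endpoint_def)
qed

text \<open>Exchanging the rays turns the inequality into an equality. Thus differences of heights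
  depend on \<open>e\<close> alone.\<close>

lemma busemann_asymptotic:
  assumes "CAT0 TYPE('m::metric_space)" "e \<in> boundary" "\<gamma> \<in> e" "\<gamma>' \<in> e"
  shows "busemann \<gamma> (x::'m) - busemann \<gamma> y = busemann \<gamma>' x - busemann \<gamma>' y"
proof -
  have r: "geodesic_ray \<gamma>" "geodesic_ray \<gamma>'" and "asymptotic \<gamma> \<gamma>'"
    using boundaryD[OF assms(2,3)] boundaryD[OF assms(2,4)] assms(4) by (auto simp: endpoint_def)
  then show ?thesis
    using busemann_asymptotic_le[OF assms(1), of \<gamma> \<gamma>' x y] busemann_asymptotic_le[OF assms(1), of \<gamma>' \<gamma> x y]
     asymptotic_sym by fastforce
qed

section \<open>Rays from a given point\<close>

text \<open>Thinness at the common starting point bounds the distance at time \<open>t\<close> by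
  \<open>t / T\<close> times the distance at time \<open>T\<close>, which stays below
  \<open>C\<close>.\<close>

lemma geodesic_ray_unique:
  assumes "CAT0 TYPE('m::metric_space)" "geodesic_ray \<gamma>" "geodesic_ray \<gamma>'" "asymptotic \<gamma> \<gamma>'"
    "\<gamma> 0 = \<gamma>' 0" "0 \<le> t"
  shows "\<gamma> t = (\<gamma>' t :: 'm)"
proof (rule ccontr)
  assume "\<gamma> t \<noteq> \<gamma>' t"
  then have d: "dist (\<gamma> t) (\<gamma>' t) > 0" by simp
  obtain C where C: "\<And>t. t \<ge> 0 \<Longrightarrow> dist (\<gamma> t) (\<gamma>' t) \<le> C" using assms(4) by (auto simp: asymptotic_def)
  \<comment> \<open>Large enough for \<open>t * C / T\<close> to drop below the supposed distance at
    time \<open>t\<close>.\<close>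
  define T where "T = t + t * C / dist (\<gamma> t) (\<gamma>' t) + 1"
  have "C \<ge> 0" using C[of 0] zero_le_dist[of "\<gamma> 0" "\<gamma>' 0"] by linarith
  then have "t * C / dist (\<gamma> t) (\<gamma>' t) \<ge> 0" using assms(6) d by simp
  then have T: "T \<ge> t" "T > 0" and T': "T > t * C / dist (\<gamma> t) (\<gamma>' t)"
    using assms(6) unfolding T_def by linarith+
  have g: "geodesic (\<gamma> 0) (\<gamma> T) \<gamma>" "geodesic (\<gamma> 0) (\<gamma>' T) \<gamma>'"
    using geodesic_ray_segment(1)[OF assms(2), of T] geodesic_ray_segment(1)[OF assms(3), of T] T assms(5) by simp_all
  have "dist (\<gamma> 0) (\<gamma> T) = T" "dist (\<gamma> 0) (\<gamma>' T) = T"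
    using geodesic_ray_segment(2)[OF assms(2), of T] geodesic_ray_segment(2)[OF assms(3), of T] T assms(5) by simp_all
  with geodesic_thin[OF assms(1) g, of "t / T"]
  have "dist (\<gamma> t) (\<gamma>' t) \<le> t / T * dist (\<gamma> T) (\<gamma>' T)" using T assms(6) by simp
  also have "\<dots> \<le> t / T * C" using C[of T] T assms(6) by (intro mult_left_mono) auto
  finally have "dist (\<gamma> t) (\<gamma>' t) * T \<le> t * C" using T by (simp add: field_simps)
  moreover have "t * C < dist (\<gamma> t) (\<gamma>' t) * T" using T' d by (simp add: field_simps)
  ultimately show False by simp
qed

lemma proper_space_Cauchy_convergent:
  fixes X :: "nat \<Rightarrow> 'm::metric_space"
  assumes "proper_space TYPE('m)" "Cauchy X"
  shows "\<exists>L. X \<longlonglongrightarrow> L"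
proof -
  have "bounded (range X)" using assms(2) by (rule cauchy_imp_bounded)
  then obtain r where "\<forall>y\<in>range X. dist (X 0) y \<le> r"
    unfolding bounded_any_center[of _ "X 0"] ..
  then have "range X \<subseteq> cball (X 0) r" by auto
  moreover have "complete (cball (X 0) r)" using assms(1) by (auto simp: proper_space_def intro: compact_imp_complete)
  ultimately show ?thesis using assms(2) unfolding complete_def by blast
qed

text \<open>The angle at \<open>b\<close> of the comparison triangle with vertices \<open>b\<close>, \<open>\<gamma> n\<close> and \<open>\<gamma> k\<close> tends to
  zero.\<close>

lemma geodesics_to_ray_close:
  fixes b :: "'m::metric_space"
  assumes "CAT0 TYPE('m)" "geodesic_ray \<gamma>" "geodesic b (\<gamma> n) c" "geodesic b (\<gamma> k) c'"
    "0 \<le> t" "2 * dist b (\<gamma> 0) + t + 1 \<le> n" "n \<le> k"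
  shows "(dist (c t) (c' t))\<^sup>2 \<le> 16 * dist b (\<gamma> 0) * t\<^sup>2 / n"
proof -
  let ?D = "dist b (\<gamma> 0)" and ?u = "dist b (\<gamma> n)" and ?v = "dist b (\<gamma> k)" and ?w = "k - n"
  have D: "?D \<ge> 0" by simp
  have n: "0 < n" "0 \<le> k" using assms(5-7) D by linarith+
  have w: "dist (\<gamma> n) (\<gamma> k) = ?w" using geodesic_rayD[OF assms(2), of n k] n assms(7) by simp
  have "dist (\<gamma> 0) (\<gamma> n) = n" "dist (\<gamma> 0) (\<gamma> k) = k" using geodesic_rayD[OF assms(2)] n assms(7) by simp_all
  then have u: "\<bar>?u - n\<bar> \<le> ?D" and v: "\<bar>?v - k\<bar> \<le> ?D"
    using dist_triangle[of b "\<gamma> n" "\<gamma> 0"] dist_triangle3[of "\<gamma> 0" "\<gamma> n" b]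
     dist_triangle[of b "\<gamma> k" "\<gamma> 0"] dist_triangle3[of "\<gamma> 0" "\<gamma> k" b] by linarith+
  have uv: "?u > 0" "?v > 0" "t \<le> ?u" "t \<le> ?v" "?D \<le> ?v" "n / 2 \<le> ?u" using u v assms(5-7) D by linarith+
  have vu: "\<bar>?v - ?u\<bar> \<le> ?w" using w dist_triangle[of b "\<gamma> n" "\<gamma> k"] dist_triangle[of b "\<gamma> k" "\<gamma> n"]
    by (simp add: dist_commute)
  have "(dist (c t) (c' t))\<^sup>2 \<le> (t / ?u)\<^sup>2 * ?u\<^sup>2 + (t / ?v)\<^sup>2 * ?v\<^sup>2 - (t / ?u) * (t / ?v) * (?u\<^sup>2 + ?v\<^sup>2 - ?w\<^sup>2)"
    using CAT0_dist_square_le[OF assms(1,3,4), of "t / ?u" "t / ?v"] uv assms(5) unfolding w by simp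
  also have "\<dots> = (t\<^sup>2 / (?u * ?v)) * ((?w - (?v - ?u)) * (?w + (?v - ?u)))"
    using uv by (simp add: field_simps power2_eq_square)
  \<comment> \<open>The first factor is at most \<open>2 * ?D\<close>, as \<open>?u\<close> and
    \<open>?v\<close> differ from \<open>n\<close> and \<open>k\<close> by at most
    \<open>?D\<close>. The second is estimated through
    \<open>?w \<le> k \<le> ?v + ?D \<le> 2 * ?v\<close>.\<close>
  also have "\<dots> \<le> (t\<^sup>2 / (?u * ?v)) * ((2 * ?D) * (4 * ?v))"
    using u v vu uv assms(7) n by (intro mult_left_mono mult_mono) (auto simp: abs_le_iff)
  also have "\<dots> = 8 * ?D * t\<^sup>2 / ?u" using uv by (simp add: field_simps)
  also have "\<dots> \<le> 8 * ?D * t\<^sup>2 / (n / 2)"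
    using uv n by (intro divide_left_mono) auto
  finally show ?thesis by simp
qed

text \<open>The ray is the pointwise limit of the geodesics from \<open>b\<close> to
  \<open>\<gamma> n\<close>, which are Cauchy by \<open>geodesics_to_ray_close\<close>.\<close>

lemma geodesic_ray_from:
  fixes b :: "'m::metric_space"
  assumes "CAT0 TYPE('m)" "proper_space TYPE('m)" "geodesic_ray \<gamma>"
  obtains \<gamma>' where "geodesic_ray \<gamma>'" "asymptotic \<gamma> \<gamma>'" "\<gamma>' 0 = b"
proof -
  have "\<forall>n. \<exists>c. geodesic b (\<gamma> (real n)) c" using assms(1) by (simp add: CAT0_def)
  then obtain c where c: "\<And>n. geodesic b (\<gamma> (real n)) (c n)" by metis
  define D where "D = dist b (\<gamma> 0)"
  have D: "D \<ge> 0" by (simp add: D_def)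
  have u: "\<bar>dist b (\<gamma> (real n)) - n\<bar> \<le> D" for n :: nat
    using dist_triangle[of b "\<gamma> n" "\<gamma> 0"] dist_triangle3[of "\<gamma> 0" "\<gamma> n" b]
      geodesic_rayD[OF assms(3), of 0 n] unfolding D_def by simp
  have cau: "Cauchy (\<lambda>n. c n t)" if t: "t \<ge> 0" for t
  proof (rule metric_CauchyI)
    fix e :: real assume e: "e > 0"
    \<comment> \<open>The last summand pushes the bound of \<open>geodesics_to_ray_close\<close>
      below \<open>e\<^sup>2\<close>; the others supply its hypothesis.\<close>
    obtain N :: nat where N: "real N \<ge> 2 * D + t + 1 + 16 * D * t\<^sup>2 / e\<^sup>2" using real_arch_simple by blast
    have close: "dist (c n t) (c k t) < e" if "N \<le> n" "n \<le> k" for n k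
    proof -
      have "real N \<le> n" "0 \<le> 16 * D * t\<^sup>2 / e\<^sup>2" using that D by simp_all
      then have n: "2 * D + t + 1 \<le> n" "16 * D * t\<^sup>2 / e\<^sup>2 < n"
        using N D t by linarith+
      have "(dist (c n t) (c k t))\<^sup>2 \<le> 16 * D * t\<^sup>2 / n"
        using geodesics_to_ray_close[OF assms(1,3) c c t, of n k] n that(2) unfolding D_def by simp
      also have "\<dots> < e\<^sup>2" using n e D t by (simp add: field_simps)
      finally show ?thesis using e by (rule_tac power2_less_imp_less) auto
    qed
    show "\<exists>N. \<forall>m\<ge>N. \<forall>n\<ge>N. dist (c m t) (c n t) < e"
      using close by (metis dist_commute nle_le)
  qed
  then have "\<forall>t. \<exists>L. t \<ge> 0 \<longrightarrow> (\<lambda>n. c n t) \<longlonglongrightarrow> L"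
    using proper_space_Cauchy_convergent[OF assms(2)] by blast
  then obtain \<gamma>' where lim: "\<And>t. t \<ge> 0 \<Longrightarrow> (\<lambda>n. c n t) \<longlonglongrightarrow> \<gamma>' t" by metis
  \<comment> \<open>\<open>c n\<close> is controlled only up to time
    \<open>dist b (\<gamma> n)\<close>, which eventually exceeds any given \<open>s\<close>.\<close>
  have large: "eventually (\<lambda>n. s \<le> dist b (\<gamma> (real n)) \<and> s \<le> n \<and> 0 < n) sequentially" for s
  proof -
    obtain N :: nat where N: "real N \<ge> \<bar>s\<bar> + D + 1" using real_arch_simple by blast
    show ?thesis using eventually_ge_at_top[of N]
    proof eventually_elim
      case (elim n)
      then have "real n \<ge> \<bar>s\<bar> + D + 1" using N by linarith
      moreover from this have "0 < real n" using D by linarith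
      ultimately show ?case using u[of n] D by auto
    qed
  qed
  have "geodesic_ray \<gamma>'" unfolding geodesic_ray_def
  proof (intro allI impI)
    fix s t :: real assume st: "s \<ge> 0" "t \<ge> 0"
    have "(\<lambda>n. dist (c n s) (c n t)) \<longlonglongrightarrow> dist (\<gamma>' s) (\<gamma>' t)"
      by (intro tendsto_dist lim st)
    moreover have "(\<lambda>n. dist (c n s) (c n t)) \<longlonglongrightarrow> \<bar>s - t\<bar>"
      using large[of s] large[of t]
      by (intro tendsto_eventually, eventually_elim) (use st in \<open>auto intro: geodesic_dist[OF c]\<close>)
    ultimately show "dist (\<gamma>' s) (\<gamma>' t) = \<bar>s - t\<bar>" by (rule LIMSEQ_unique)
  qed
  moreover have "asymptotic \<gamma> \<gamma>'" unfolding asymptotic_def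
  proof (intro exI[of _ "2 * D"] allI impI)
    fix t :: real assume t: "t \<ge> 0"
    have "(\<lambda>n. dist (\<gamma> t) (c n t)) \<longlonglongrightarrow> dist (\<gamma> t) (\<gamma>' t)"
      by (intro tendsto_dist lim t tendsto_const)
    moreover have "eventually (\<lambda>n. dist (\<gamma> t) (c n t) \<le> 2 * D) sequentially"
      using large[of t]
    proof eventually_elim
      case (elim n)
      let ?u = "dist b (\<gamma> (real n))" and ?l = "1 - t / n"
      \<comment> \<open>Both geodesics are reversed so as to start at \<open>\<gamma> n\<close>.
        Thinness there bounds the distance at equal proportions by \<open>D\<close>; passing from
        the parameter \<open>t / n * ?u\<close> to \<open>t\<close> costs another
        \<open>D\<close>.\<close>
      note g1 = geodesic_reverse[OF c[of n]]
      note g2 = geodesic_reverse[OF geodesic_ray_segment(1)[OF assms(3) of_nat_0_le_iff[of n]]]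
      have dn: "dist (\<gamma> 0) (\<gamma> n) = n" using geodesic_rayD[OF assms(3), of 0 n] by simp
      have l: "0 \<le> ?l" "?l \<le> 1" using elim t by auto
      have "dist (c n (?u - ?l * ?u)) (\<gamma> (n - ?l * n)) \<le> ?l * D"
        using geodesic_thin[OF assms(1) g1 g2 l] dn unfolding D_def by (simp add: dist_commute)
      also have "\<dots> \<le> D" using l D by (simp add: mult_left_le_one_le)
      finally have 1: "dist (c n (t / n * ?u)) (\<gamma> t) \<le> D" using elim by (simp add: algebra_simps)
      have "t / n * ?u \<le> 1 * ?u" using elim t by (intro mult_right_mono) auto
      then have "dist (c n (t / n * ?u)) (c n t) = \<bar>t / n * ?u - t\<bar>"
        using elim t by (intro geodesic_dist[OF c]) auto
      also have "\<dots> = t / n * \<bar>?u - n\<bar>" 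
      proof -
        have "t / n * ?u - t = t / n * (?u - n)" using elim by (simp add: field_simps)
        then show ?thesis using elim t by (simp add: abs_mult)
      qed
      also have "\<dots> \<le> 1 * D" using u[of n] elim t by (intro mult_mono) auto
      finally show ?case using 1 dist_triangle3[of "\<gamma> t" "c n t" "c n (t / n * ?u)"] by simp
    qed
    ultimately show "dist (\<gamma> t) (\<gamma>' t) \<le> 2 * D" by (rule tendsto_upperbound) simp
  qed
  moreover have "\<gamma>' 0 = b"
    using lim[of 0] geodesic_start[OF c] by (simp add: LIMSEQ_const_iff)
  ultimately show ?thesis using that by blast
qed

text \<open>The rays from \<open>b\<close> to two different boundary points differ at some time
  \<open>t\<close>, and avoiding \<open>\<gamma> t\<close> at that time is an open condition. For a
  fixed point \<open>e\<close>, whose orbit is \<open>{e}\<close>, this identifies the two versions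
  of the invariant.\<close>

lemma closure_of_cone_topology_singleton:
  fixes b :: "'m::metric_space"
  assumes "CAT0 TYPE('m)" "proper_space TYPE('m)" "e \<in> boundary"
  shows "cone_topology b closure_of {e} = {e}"
proof -
  let ?O = "\<lambda>K U. {e \<in> boundary. \<exists>\<gamma>\<in>e. \<gamma> 0 = b \<and> \<gamma> ` K \<subseteq> U}"
  have op: "openin (cone_topology b) (?O K U)" if "K \<subseteq> {0..}" "compact K" "open U" for K U
    unfolding cone_topology_def using that by (intro topology_generated_by_Basis) blast
  obtain \<gamma>0 where "\<gamma>0 \<in> e" using boundary_nonempty[OF assms(3)] .
  with boundaryD[OF assms(3)] have \<gamma>0: "geodesic_ray \<gamma>0" "e = endpoint \<gamma>0" by blast+
  obtain \<gamma> where \<gamma>: "geodesic_ray \<gamma>" "asymptotic \<gamma>0 \<gamma>" "\<gamma> 0 = b"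
    using geodesic_ray_from[OF assms(1,2) \<gamma>0(1)] .
  then have \<gamma>e: "\<gamma> \<in> e" using \<gamma>0 by (simp add: endpoint_def)
  \<comment> \<open>Even the basic set for \<open>K = {}\<close> demands a ray from \<open>b\<close>
    in the class, so its existence is what puts \<open>e\<close> into the space.\<close>
  have "e \<in> ?O {} UNIV" using \<gamma> \<gamma>e assms(3) by auto
  then have top: "e \<in> topspace (cone_topology b)"
    using op[of "{}" UNIV] openin_subset by fastforce
  have "e' = e" if e': "e' \<in> cone_topology b closure_of {e}" for e'
  proof (rule ccontr)
    assume "e' \<noteq> e"
    have "e' \<in> topspace (cone_topology b)" using e' by (simp add: in_closure_of)
    then obtain \<gamma>' where g': "e' \<in> boundary" "\<gamma>' \<in> e'" "\<gamma>' 0 = b"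
      unfolding cone_topology_def topology_generated_by_topspace by blast
    note \<gamma>' = boundaryD[OF g'(1,2)]
    have "\<exists>t\<ge>0. \<gamma> t \<noteq> \<gamma>' t"
    proof (rule ccontr)
      assume "\<not> ?thesis"
      then have "asymptotic \<gamma>' \<gamma>" by (auto simp: asymptotic_def intro: exI[of _ 0])
      then have "\<gamma> \<in> e'" using \<gamma>' \<gamma>(1) by (simp add: endpoint_def)
      then show False using \<open>e' \<noteq> e\<close> boundaryD(2)[OF g'(1)] boundaryD(2)[OF assms(3) \<gamma>e] by blast
    qed
    then obtain t where t: "t \<ge> 0" "\<gamma> t \<noteq> \<gamma>' t" by blast
    have sep: "openin (cone_topology b) T \<Longrightarrow> e' \<in> T \<Longrightarrow> e \<in> T" for T
      using e' by (auto simp: in_closure_of)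
    have "e \<in> ?O {t} (- {\<gamma> t})"
    proof (rule sep)
      show "openin (cone_topology b) (?O {t} (- {\<gamma> t}))" using t by (intro op) auto
      show "e' \<in> ?O {t} (- {\<gamma> t})" using g' t by auto
    qed
    then obtain \<gamma>'' where g'': "\<gamma>'' \<in> e" "\<gamma>'' 0 = b" "\<gamma>'' t \<noteq> \<gamma> t" by auto
    have "geodesic_ray \<gamma>''" "asymptotic \<gamma>'' \<gamma>"
      using boundaryD[OF assms(3) g''(1)] \<gamma>e by (auto simp: endpoint_def)
    then show False using geodesic_ray_unique[OF assms(1) _ \<gamma>(1) _ _ t(1)] g'' \<gamma>(3) by metis
  qed
  moreover have "e \<in> cone_topology b closure_of {e}" using closure_of_subset[of "{e}"] top by auto
  ultimately show ?thesis by auto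
qed

lemma Sigma_action_circ_fixed_point:
  fixes b :: "'m::metric_space"
  assumes "CAT0 TYPE('m)" "proper_space TYPE('m)" "e \<in> boundary" "group G"
    "\<forall>g\<in>carrier G. boundary_map (\<rho> g) e = e"
  shows "e \<in> Sigma_action_circ U b n G \<rho> \<longleftrightarrow> e \<in> Sigma_action U n G \<rho>"
proof -
  have "orbit G (\<lambda>g. boundary_map (\<rho> g)) e = {e}"
    using assms(4,5) group.is_monoid monoid.one_closed unfolding orbit_def by fastforce
  then show ?thesis
    using assms(3) closure_of_cone_topology_singleton[OF assms(1-3)] by (simp add: Sigma_action_circ_def)
qed

section \<open>The induced character\<close>

lemma isometric_actionD:
  assumes "isometric_action G \<rho>"
  shows "g \<in> carrier G \<Longrightarrow> dist (\<rho> g x) (\<rho> g y) = dist x y"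
    and "g \<in> carrier G \<Longrightarrow> h \<in> carrier G \<Longrightarrow> \<rho> (g \<otimes>\<^bsub>G\<^esub> h) x = \<rho> g (\<rho> h x)"
    and "\<rho> \<one>\<^bsub>G\<^esub> x = x"
proof -
  have a: "group_action G UNIV \<rho>" using assms by (simp add: isometric_action_def)
  show "g \<in> carrier G \<Longrightarrow> dist (\<rho> g x) (\<rho> g y) = dist x y"
    using assms by (simp add: isometric_action_def)
  show "g \<in> carrier G \<Longrightarrow> h \<in> carrier G \<Longrightarrow> \<rho> (g \<otimes>\<^bsub>G\<^esub> h) x = \<rho> g (\<rho> h x)"
    by (rule group_action.composition_rule[OF a]) simp
  show "\<rho> \<one>\<^bsub>G\<^esub> x = x" using group_action.id_eq_one[OF a] by (metis UNIV_I restrict_apply)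
qed

text \<open>The height of \<open>\<rho> g x\<close> is the height of \<open>x\<close> with respect
  to the ray moved by the inverse of \<open>g\<close>. That ray again lies in \<open>e\<close>, so
  the heights differ by a constant. This also justifies the \<open>THE\<close> in
  \<open>induced_character\<close>.\<close>

lemma busemann_action:
  fixes \<rho> :: "'g \<Rightarrow> 'm::metric_space \<Rightarrow> 'm"
  assumes "group G" "CAT0 TYPE('m)" "e \<in> boundary" "isometric_action G \<rho>"
    "\<forall>g\<in>carrier G. boundary_map (\<rho> g) e = e" "\<gamma> \<in> e" "g \<in> carrier G"
  shows "busemann \<gamma> (\<rho> g a) = busemann \<gamma> a + induced_character \<rho> e g"
proof -
  interpret group G by fact
  note \<rho> = isometric_actionD[OF assms(4)]
  have ig: "inv\<^bsub>G\<^esub> g \<in> carrier G" using assms(7) by simp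
  let ?\<gamma>' = "\<rho> (inv\<^bsub>G\<^esub> g) \<circ> \<gamma>"
  have \<gamma>': "?\<gamma>' \<in> e" using assms(5,6) ig unfolding boundary_map_def by blast
  have "dist (\<rho> g x) y = dist x (\<rho> (inv\<^bsub>G\<^esub> g) y)" for x y
    using \<rho>(1)[OF ig, of "\<rho> g x" y] \<rho>(2)[OF ig assms(7)] assms(7) by (simp add: \<rho>(3))
  then have "busemann \<gamma> (\<rho> g x) = busemann ?\<gamma>' x" for x by (simp add: busemann_def)
  then have indep: "busemann \<gamma> (\<rho> g x) - busemann \<gamma> x = busemann \<gamma> (\<rho> g y) - busemann \<gamma> y" for x y
    using busemann_asymptotic[OF assms(2,3) \<gamma>' assms(6), of x y] by simp
  have all: "\<forall>\<gamma>'\<in>e. \<forall>x. busemann \<gamma>' (\<rho> g x) - busemann \<gamma>' x = busemann \<gamma> (\<rho> g a) - busemann \<gamma> a"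
    using busemann_asymptotic[OF assms(2,3) _ assms(6)] indep by metis
  have "induced_character \<rho> e g = busemann \<gamma> (\<rho> g a) - busemann \<gamma> a"
    unfolding induced_character_def
  proof (rule the_equality)
    show "r = busemann \<gamma> (\<rho> g a) - busemann \<gamma> a"
      if "\<forall>\<gamma>\<in>e. \<forall>a. busemann \<gamma> (\<rho> g a) - busemann \<gamma> a = r" for r
      using that assms(6) by auto
  qed (fact all)
  then show ?thesis by simp
qed

lemma induced_character_mult:
  fixes \<rho> :: "'g \<Rightarrow> 'm::metric_space \<Rightarrow> 'm"
  assumes "group G" "CAT0 TYPE('m)" "e \<in> boundary" "isometric_action G \<rho>"
    "\<forall>g\<in>carrier G. boundary_map (\<rho> g) e = e" "g \<in> carrier G" "h \<in> carrier G"
  shows "induced_character \<rho> e (g \<otimes>\<^bsub>G\<^esub> h) = induced_character \<rho> e g + induced_character \<rho> e h"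
proof -
  obtain \<gamma> where \<gamma>: "\<gamma> \<in> e" using boundary_nonempty[OF assms(3)] .
  note B = busemann_action[OF assms(1-5) \<gamma>]
  have "g \<otimes>\<^bsub>G\<^esub> h \<in> carrier G" using assms(1,6,7) by (simp add: group.is_monoid monoid.m_closed)
  from B[OF this, of undefined] B[OF assms(6), of "\<rho> h undefined"] B[OF assms(7), of undefined]
  show ?thesis by (simp add: isometric_actionD(2)[OF assms(4,6,7)])
qed

section \<open>Rays in the line\<close>

lemma endpoint_real_line: "endpoint (\<lambda>t::real. t) \<in> boundary" "(\<lambda>t. t) \<in> endpoint (\<lambda>t::real. t)"
proof -
  have "geodesic_ray (\<lambda>t::real. t)" by (simp add: geodesic_ray_def dist_real_def)
  then show "endpoint (\<lambda>t::real. t) \<in> boundary" "(\<lambda>t. t) \<in> endpoint (\<lambda>t::real. t)"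
    unfolding boundary_def by (blast, auto simp: endpoint_def asymptotic_def intro: exI[of _ 0])
qed

text \<open>A ray in this class equals \<open>\<gamma> 0 + t\<close> for large \<open>t\<close>. The
  choice of the ray thus shifts heights by \<open>\<gamma> 0\<close>, which has to be undone when a
  character is compared with \<open>\<rho>\<close>.\<close>

lemma busemann_real_line:
  assumes "\<gamma> \<in> endpoint (\<lambda>t::real. t)"
  shows "busemann \<gamma> r = r - \<gamma> 0"
proof -
  obtain C where C: "\<And>t. t \<ge> 0 \<Longrightarrow> \<bar>t - \<gamma> t\<bar> \<le> C" and ray: "geodesic_ray \<gamma>"
    using assms by (auto simp: endpoint_def asymptotic_def dist_real_def)
  \<comment> \<open>The alternative \<open>\<gamma> t = \<gamma> 0 - t\<close> would be further than
    \<open>C\<close> away from \<open>t\<close>.\<close>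
  have *: "\<gamma> t = \<gamma> 0 + t" if "t > C + \<bar>\<gamma> 0\<bar>" "t \<ge> 0" for t
    using geodesic_rayD[OF ray, of 0 t] C[of t] that by (auto simp: dist_real_def)
  have "eventually (\<lambda>t. t - dist r (\<gamma> t) = r - \<gamma> 0) at_top"
    using eventually_gt_at_top[of "C + \<bar>\<gamma> 0\<bar> + \<bar>r\<bar>"] eventually_ge_at_top[of "\<bar>r\<bar> + \<bar>\<gamma> 0\<bar>"]
  proof eventually_elim
    case (elim t)
    then have "\<gamma> t = \<gamma> 0 + t" by (intro *) linarith+
    then show ?case using elim by (auto simp: dist_real_def)
  qed
  then show ?thesis by (intro busemann_eqI tendsto_eventually)
qed

section \<open>Discs\<close>

lemma topspace_disc: "topspace (disc n) = {x. (\<forall>i\<ge>n. x i = 0) \<and> (\<Sum>i<n. (x i)\<^sup>2) \<le> 1}"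
  by (auto simp: disc_def topspace_Euclidean_space)

text \<open>This makes the type-class notions \<open>compact\<close> and
  \<open>continuous_on\<close> on the function space available for discs.\<close>

lemma disc_eq_top_of_set: "disc n = top_of_set (topspace (disc n))"
  unfolding topspace_disc
  by (simp add: disc_def Euclidean_space_def subtopology_subtopology euclidean_product_topology Collect_conj_eq)

lemma continuous_map_disc_iff: "continuous_map (disc n) euclidean f \<longleftrightarrow> continuous_on (topspace (disc n)) f"
  by (subst disc_eq_top_of_set) simp

lemma continuous_on_coordinate: "continuous_on S (\<lambda>x::'i \<Rightarrow> real. x i)"
  by (rule continuous_on_subset[OF continuous_on_product_coordinates subset_UNIV])

lemma continuous_on_L2_set:
  fixes f :: "'a::topological_space \<Rightarrow> 'i \<Rightarrow> real"
  assumes "\<And>i. continuous_on S (\<lambda>x. f x i)"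
  shows "continuous_on S (\<lambda>x. L2_set (f x) I)"
  unfolding L2_set_def by (intro continuous_intros assms)

lemma compact_disc: "compact (topspace (disc n))"
proof -
  have "compactin (product_topology (\<lambda>i::nat. euclideanreal) UNIV) (PiE UNIV (\<lambda>i. {-1..1}))"
    by (simp add: compactin_PiE)
  then have K: "compact (PiE UNIV (\<lambda>i::nat. {-1..1::real}))"
    by (simp add: euclidean_product_topology)
  have "closed (topspace (disc n))"
  proof -
    have "topspace (disc n) = (\<Inter>i\<in>{n..}. {x. x i = 0}) \<inter> {x. (\<Sum>i<n. (x i)\<^sup>2) \<le> 1}"
      by (auto simp: topspace_disc)
    also have "closed \<dots>"
      by (intro closed_Int closed_INT ballI closed_Collect_eq closed_Collect_le continuous_intros
          continuous_on_coordinate)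
    finally show ?thesis .
  qed
  moreover have "topspace (disc n) \<subseteq> PiE UNIV (\<lambda>i. {-1..1})"
  proof
    fix x assume x: "x \<in> topspace (disc n)"
    have "\<bar>x i\<bar> \<le> 1" for i
    proof (cases "i < n")
      case True
      then have "(x i)\<^sup>2 \<le> (\<Sum>i<n. (x i)\<^sup>2)" by (intro member_le_sum) auto
      then have "(x i)\<^sup>2 \<le> 1" using x by (auto simp: topspace_disc)
      then show ?thesis by (simp add: abs_square_le_1)
    qed (use x in \<open>auto simp: topspace_disc\<close>)
    then show "x \<in> PiE UNIV (\<lambda>i. {-1..1})" by (auto simp: abs_le_iff minus_le_iff)
  qed
  ultimately show ?thesis using compact_Int_closed[OF K] by (metis inf.absorb_iff2)
qed

text \<open>The norm \<open>L2_set\<close> comes with homogeneity and the triangle inequality, which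
  the sums of squares lack.\<close>

lemma L2_set_disc:
  "x \<in> topspace (disc n) \<longleftrightarrow> (\<forall>i\<ge>n. x i = 0) \<and> L2_set x {..<n} \<le> 1"
  "(\<Sum>i<n. (x i)\<^sup>2) = 1 \<longleftrightarrow> L2_set x {..<n} = 1"
  "(\<Sum>i<n. (x i)\<^sup>2) < 1 \<longleftrightarrow> L2_set x {..<n} < 1"
  by (simp_all add: topspace_disc L2_set_def)

text \<open>\<open>b\<close> is coned off to \<open>q\<close> by means of a factor \<open>m\<close> that vanishes at the centre of the disc and at
  \<open>y\<close>, so that \<open>y\<close> is sent to \<open>q\<close>. The result is then moved towards a point \<open>\<gamma> T\<close> of large height; by
  concavity of the Busemann function this raises it above \<open>F\<close>, and nothing is moved where it lies above
  \<open>F\<close> already.\<close>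

lemma disc_extension_above:
  fixes b :: "(nat \<Rightarrow> real) \<Rightarrow> 'm::metric_space"
  assumes C0: "CAT0 TYPE('m)" and ray: "geodesic_ray \<gamma>"
    and F: "continuous_on (topspace (disc n)) F"
    and b: "continuous_on {x \<in> topspace (disc n). (\<Sum>i<n. (x i)\<^sup>2) = 1} b"
    and Fb: "\<And>x. x \<in> topspace (disc n) \<Longrightarrow> (\<Sum>i<n. (x i)\<^sup>2) = 1 \<Longrightarrow> F x \<le> busemann \<gamma> (b x)"
    and y: "y \<in> topspace (disc n)" "(\<Sum>i<n. (y i)\<^sup>2) < 1" and q: "busemann \<gamma> q = F y"
  obtains H where "continuous_on (topspace (disc n)) H"
    "\<And>x. x \<in> topspace (disc n) \<Longrightarrow> (\<Sum>i<n. (x i)\<^sup>2) = 1 \<Longrightarrow> H x = b x"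
    "\<And>x. x \<in> topspace (disc n) \<Longrightarrow> F x \<le> busemann \<gamma> (H x)"
    "busemann \<gamma> (H y) = F y"
proof -
  let ?S = "topspace (disc n)"
  define E where "E = {x \<in> ?S. (\<Sum>i<n. (x i)\<^sup>2) = 1}"
  define N where "N = (\<lambda>z::nat \<Rightarrow> real. L2_set z {..<n})"
  \<comment> \<open>The factor \<open>N z\<close> tames the centre, where the radial projection in
    \<open>B\<close> has no meaning. The other factor is 1 on the unit sphere, whose points are at
    distance at least \<open>1 - N y\<close> from \<open>y\<close>.\<close>
  define m where "m = (\<lambda>z. N z * min 1 (N (\<lambda>i. z i - y i) / (1 - N y)))"
  define B where "B = (\<lambda>z. b (\<lambda>i. z i / N z))"
  define H0 where "H0 = (\<lambda>z. comb q (B z) (m z))"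
  have E: "x \<in> E \<longleftrightarrow> x \<in> ?S \<and> N x = 1" for x by (simp add: E_def N_def L2_set_disc)
  have Ny: "N y < 1" using y(2) by (simp add: N_def L2_set_disc)
  have N0: "N z \<ge> 0" for z by (simp add: N_def L2_set_nonneg)
  have NS: "z \<in> ?S \<Longrightarrow> N z \<le> 1" for z by (simp add: N_def L2_set_disc)
  have contN: "continuous_on A N" for A
    unfolding N_def by (intro continuous_on_L2_set continuous_on_coordinate)
  have contm: "continuous_on A m" for A
    unfolding m_def N_def by (intro continuous_intros continuous_on_L2_set continuous_on_coordinate)
     (use Ny in \<open>simp add: N_def\<close>)
  have m01: "0 \<le> m z \<and> m z \<le> 1" if "z \<in> ?S" for z
    using N0 NS[OF that] Ny unfolding m_def by (auto intro!: mult_le_one)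
  have mN: "m z \<le> N z" for z
    using N0 Ny unfolding m_def by (intro mult_left_le) auto
  have BE: "(\<lambda>i. z i / N z) \<in> E" if "z \<in> ?S" "N z > 0" for z
  proof -
    have "N (\<lambda>i. z i / N z) = 1"
      using L2_set_left_distrib[of "inverse (N z)" z "{..<n}"] that(2)
      by (simp add: N_def divide_inverse)
    then show ?thesis using that by (simp add: E L2_set_disc(1) N_def)
  qed
  have "compact E" 
  proof -
    have "E = ?S \<inter> {x. N x = 1}" by (auto simp: E)
    then show ?thesis using compact_disc by (auto intro!: compact_Int_closed closed_Collect_eq contN)
  qed
  then have "bounded (b ` E)" using b compact_continuous_image compact_imp_bounded unfolding E_def by blast
  then obtain K where K: "\<forall>x\<in>b ` E. dist q x \<le> K" unfolding bounded_any_center[of _ q] ..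
  have contH0: "continuous_on ?S H0"
    unfolding continuous_on_def
  proof
    fix x assume x: "x \<in> ?S"
    show "(H0 \<longlongrightarrow> H0 x) (at x within ?S)"
    proof (cases "N x = 0")
      case False
      let ?U = "{z \<in> ?S. N z > 0}"
      have "continuous_on ?U (\<lambda>z. (\<lambda>i. z i / N z))"
        by (intro continuous_on_coordinatewise_then_product continuous_intros contN
            continuous_on_coordinate) auto
      then have "continuous_on ?U B"
        unfolding B_def using BE by (intro continuous_on_compose2[OF b]) (auto simp: E_def)
      then have "continuous_on ?U H0"
        unfolding H0_def using m01 by (intro continuous_on_comb[OF C0] contm) auto
      then have "(H0 \<longlongrightarrow> H0 x) (at x within ?U)"
        using x False N0[of x] by (auto simp: continuous_on_def)
      moreover have "at x within ?U = at x within ?S"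
      proof (rule at_within_nhd[of x "{z. N z > 0}"])
        show "open {z. N z > 0}" by (intro open_Collect_less contN continuous_on_const)
      qed (use x False N0[of x] in auto)
      ultimately show ?thesis by simp
    next
      case True
      then have Hx: "H0 x = q" using C0 by (simp add: H0_def m_def comb_0)
      have "((\<lambda>z. N z * K) \<longlongrightarrow> N x * K) (at x within ?S)"
        using contN[of ?S] x by (auto simp: continuous_on_def intro: tendsto_mult_right)
      then have lim: "((\<lambda>z. N z * K) \<longlongrightarrow> 0) (at x within ?S)" using True by simp
      \<comment> \<open>Boundary values have bounded distance from \<open>q\<close>, and
        \<open>m z \<le> N z\<close>; this forces convergence to \<open>q\<close> at the
        centre.\<close>
      have "dist (H0 z) q \<le> N z * K" if z: "z \<in> ?S" for z
      proof (cases "N z = 0")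
        case True
        then show ?thesis using C0 by (simp add: H0_def m_def comb_0)
      next
        case False
        have "dist (H0 z) q = m z * dist q (B z)"
          using dist_comb_same[OF C0, of "m z" 0 q "B z"] m01[OF z] C0 by (simp add: H0_def comb_0)
        also have "\<dots> \<le> N z * K"
          using K BE[OF z] False N0[of z] m01[OF z] mN by (intro mult_mono) (auto simp: B_def)
        finally show ?thesis .
      qed
      then have "\<forall>\<^sub>F z in at x within ?S. norm (dist (H0 z) q) \<le> N z * K"
        by (simp add: eventually_at_filter)
      from Lim_null_comparison[OF this lim] show ?thesis
        unfolding Hx by (simp add: tendsto_dist_iff[symmetric])
    qed
  qed
  let ?\<beta> = "busemann \<gamma>"
  have cb: "continuous_on A ?\<beta>" for A by (rule continuous_on_busemann[OF ray])
  have c\<beta>: "continuous_on ?S (\<lambda>z. ?\<beta> (H0 z))"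
    by (rule continuous_on_compose2[OF cb[of UNIV] contH0]) simp
  have "bounded (F ` ?S)" "bounded ((\<lambda>z. ?\<beta> (H0 z)) ` ?S)"
    using F c\<beta> compact_disc by (auto intro: compact_imp_bounded compact_continuous_image)
  then obtain K1 K2 where K1: "\<And>z. z \<in> ?S \<Longrightarrow> \<bar>F z\<bar> \<le> K1" and K2: "\<And>z. z \<in> ?S \<Longrightarrow> \<bar>?\<beta> (H0 z)\<bar> \<le> K2"
    unfolding bounded_iff by auto
  \<comment> \<open>\<open>T\<close> lies above \<open>F\<close> and strictly above all heights of
    \<open>H0\<close>, so the denominator of \<open>\<tau>\<close> is positive and
    \<open>\<tau>\<close> is at most 1.\<close>
  define T where "T = \<bar>K1\<bar> + \<bar>K2\<bar> + 1"
  have T: "?\<beta> (\<gamma> T) = T" using ray by (intro busemann_ray) (auto simp: T_def)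
  have FT: "F z \<le> T" and \<beta>T: "?\<beta> (H0 z) < T" if "z \<in> ?S" for z
    using K1[OF that] K2[OF that] unfolding T_def by linarith+
  \<comment> \<open>This is the fraction of the climb to height \<open>T\<close> that guarantees
    height \<open>F z\<close> by concavity.\<close>
  define \<tau> where "\<tau> = (\<lambda>z. max 0 (F z - ?\<beta> (H0 z)) / (T - ?\<beta> (H0 z)))"
  \<comment> \<open>\<open>continuous_on_comb\<close> wants a fixed starting point. The combing
    therefore starts at \<open>\<gamma> T\<close>, with reversed parameter.\<close>
  define H where "H = (\<lambda>z. comb (\<gamma> T) (H0 z) (1 - \<tau> z))"
  have \<tau>01: "0 \<le> \<tau> z \<and> \<tau> z \<le> 1" if "z \<in> ?S" for z
    using FT[OF that] \<beta>T[OF that] by (auto simp: \<tau>_def)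
  have \<tau>0: "H z = H0 z" if "F z \<le> ?\<beta> (H0 z)" for z
    using that C0 by (simp add: H_def \<tau>_def comb_1)
  have c\<tau>: "continuous_on ?S \<tau>"
    unfolding \<tau>_def by (intro continuous_intros F c\<beta>) (use \<beta>T in fastforce)
  have "continuous_on ?S H"
    unfolding H_def using \<tau>01 by (intro continuous_on_comb[OF C0] contH0 continuous_intros c\<tau>) auto
  moreover have "H x = b x" if "x \<in> ?S" "(\<Sum>i<n. (x i)\<^sup>2) = 1" for x
  proof -
    have Nx: "N x = 1" using that(2) by (simp add: N_def L2_set_disc)
    have "N (\<lambda>i. (x i - y i) + y i) \<le> N (\<lambda>i. x i - y i) + N y"
      unfolding N_def by (rule L2_set_triangle_ineq)
    then have "m x = 1" using Nx Ny by (simp add: m_def)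
    then have "H0 x = b x" using C0 Nx by (simp add: H0_def B_def comb_1)
    then show ?thesis using \<tau>0[of x] Fb[OF that] by simp
  qed
  moreover have "F x \<le> ?\<beta> (H x)" if x: "x \<in> ?S" for x
  proof -
    have "F x \<le> ?\<beta> (H0 x) + \<tau> x * (T - ?\<beta> (H0 x))"
      using \<beta>T[OF x] by (simp add: \<tau>_def)
    also have "\<dots> = (1 - (1 - \<tau> x)) * ?\<beta> (\<gamma> T) + (1 - \<tau> x) * ?\<beta> (H0 x)"
      by (simp add: T algebra_simps)
    also have "\<dots> \<le> ?\<beta> (H x)"
      unfolding H_def using \<tau>01[OF x] by (intro busemann_comb_concave C0 ray) auto
    finally show ?thesis .
  qed
  moreover have "?\<beta> (H y) = F y"
  proof -
    have "m y = 0" by (simp add: m_def N_def L2_set_def)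
    then have "H0 y = q" using C0 by (simp add: H0_def comb_0)
    then show ?thesis using \<tau>0[of y] q by simp
  qed
  ultimately show ?thesis using that by blast
qed

section \<open>Cells and subcomplexes\<close>

lemma cw_complexD:
  assumes "cw_complex X cells"
  shows "Hausdorff_space X" "topspace X = (\<Union>n. \<Union>(cells n))"
    "\<And>m n c d x. c \<in> cells m \<Longrightarrow> d \<in> cells n \<Longrightarrow> x \<in> c \<Longrightarrow> x \<in> d \<Longrightarrow> m = n \<and> c = d"
    "\<And>A. A \<subseteq> topspace X \<Longrightarrow> (\<And>n c. c \<in> cells n \<Longrightarrow> closedin X (A \<inter> X closure_of c)) \<Longrightarrow> closedin X A"
proof -
  note * = assms[unfolded cw_complex_def]
  show "Hausdorff_space X" by (rule *[THEN conjunct1])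
  show "topspace X = (\<Union>n. \<Union>(cells n))" by (rule *[THEN conjunct2, THEN conjunct1])
  have "\<forall>m n. \<forall>c\<in>cells m. \<forall>d\<in>cells n. (m, c) \<noteq> (n, d) \<longrightarrow> disjnt c d"
    by (rule *[THEN conjunct2, THEN conjunct2, THEN conjunct1])
  then show "m = n \<and> c = d" if "c \<in> cells m" "d \<in> cells n" "x \<in> c" "x \<in> d" for m n c d x
    using that unfolding disjnt_iff by blast
  have "\<forall>A\<subseteq>topspace X. (\<forall>n. \<forall>c\<in>cells n. closedin X (A \<inter> X closure_of c)) \<longrightarrow> closedin X A"
    by (rule *[THEN conjunct2, THEN conjunct2, THEN conjunct2, THEN conjunct2])
  then show "closedin X A" if "A \<subseteq> topspace X" "\<And>n c. c \<in> cells n \<Longrightarrow> closedin X (A \<inter> X closure_of c)" for A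
    using that by simp
qed

text \<open>Shrinking towards the centre shows that the open disc is dense in the closed
  one.\<close>

lemma scaled_disc_limit:
  assumes "x \<in> topspace (disc n)"
  shows "(\<lambda>k. \<lambda>i. (1 - inverse (real (Suc k))) * x i) \<longlonglongrightarrow> x"
    and "(\<lambda>i. (1 - inverse (real (Suc k))) * x i) \<in> {x \<in> topspace (disc n). (\<Sum>i<n. (x i)\<^sup>2) < 1}"
proof -
  have "(\<lambda>k. 1 - inverse (real (Suc k))) \<longlonglongrightarrow> 1 - 0"
    by (intro tendsto_intros LIMSEQ_inverse_real_of_nat)
  moreover have "continuous_on UNIV (\<lambda>r::real. \<lambda>i. r * x i)" by (intro continuous_intros)
  ultimately have "(\<lambda>k. (\<lambda>r i. r * x i) (1 - inverse (real (Suc k)))) \<longlonglongrightarrow> (\<lambda>r i. r * x i) (1 - 0)"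
    by (intro continuous_on_tendsto_compose[of UNIV "\<lambda>r i. r * x i"]) auto
  then show "(\<lambda>k. \<lambda>i. (1 - inverse (real (Suc k))) * x i) \<longlonglongrightarrow> x"
    by simp
next
  let ?r = "1 - inverse (real (Suc k))"
  have r: "0 \<le> ?r" "?r < 1" by (auto simp: field_simps)
  have "L2_set (\<lambda>i. ?r * x i) {..<n} = ?r * L2_set x {..<n}"
    using r by (metis L2_set_right_distrib)
  also have "\<dots> \<le> ?r * 1" using assms r by (intro mult_left_mono) (auto simp: L2_set_disc)
  also have "\<dots> < 1" using r(2) by simp
  finally show "(\<lambda>i. ?r * x i) \<in> {x \<in> topspace (disc n). (\<Sum>i<n. (x i)\<^sup>2) < 1}"
    using assms by (auto simp: L2_set_disc)
qed

text \<open>The image of the closed disc is compact, hence closed in the Hausdorff space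
  \<open>X\<close>, and so contains the closure of \<open>c\<close>. Density of the open disc gives
  the reverse inclusion.\<close>

lemma cw_characteristic_map:
  assumes cw: "cw_complex X cells" and c: "c \<in> cells n"
  obtains \<Phi> F where "continuous_map (disc n) X \<Phi>"
    "\<Phi> ` {x \<in> topspace (disc n). (\<Sum>i<n. (x i)\<^sup>2) < 1} = c"
    "inj_on \<Phi> {x \<in> topspace (disc n). (\<Sum>i<n. (x i)\<^sup>2) < 1}"
    "\<Phi> ` topspace (disc n) = X closure_of c"
    "finite F" "F \<subseteq> (\<Union>m<n. cells m)"
    "\<Phi> ` {x \<in> topspace (disc n). (\<Sum>i<n. (x i)\<^sup>2) = 1} \<subseteq> \<Union>F"
proof -
  let ?I = "{x \<in> topspace (disc n). (\<Sum>i<n. (x i)\<^sup>2) < 1}"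
  have "\<exists>\<Phi>. continuous_map (disc n) X \<Phi> \<and>
        homeomorphic_map (subtopology (disc n) {x. (\<Sum>i<n. (x i)\<^sup>2) < 1}) (subtopology X c) \<Phi> \<and>
        (\<exists>F. finite F \<and> F \<subseteq> (\<Union>m<n. cells m) \<and>
           \<Phi> ` {x \<in> topspace (disc n). (\<Sum>i<n. (x i)\<^sup>2) = 1} \<subseteq> \<Union>F)"
    using cw c unfolding cw_complex_def by blast
  then obtain \<Phi> F where \<Phi>: "continuous_map (disc n) X \<Phi>"
     "homeomorphic_map (subtopology (disc n) {x. (\<Sum>i<n. (x i)\<^sup>2) < 1}) (subtopology X c) \<Phi>"
     "finite F" "F \<subseteq> (\<Union>m<n. cells m)" "\<Phi> ` {x \<in> topspace (disc n). (\<Sum>i<n. (x i)\<^sup>2) = 1} \<subseteq> \<Union>F" by blast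
  have cX: "c \<subseteq> topspace X" using cw_complexD(2)[OF cw] c by blast
  have I: "topspace (subtopology (disc n) {x. (\<Sum>i<n. (x i)\<^sup>2) < 1}) = ?I" by auto
  have surj: "\<Phi> ` ?I = c" using homeomorphic_imp_surjective_map[OF \<Phi>(2)] cX unfolding I by auto
  have inj: "inj_on \<Phi> ?I" using homeomorphic_imp_injective_map[OF \<Phi>(2)] unfolding I .
  have "compactin X (\<Phi> ` topspace (disc n))"
  proof (rule image_compactin[OF _ \<Phi>(1)])
    have "compact_space (top_of_set (topspace (disc n)))" using compact_disc by (simp add: compact_space_subtopology)
    then show "compactin (disc n) (topspace (disc n))"
      using disc_eq_top_of_set[of n] by (simp add: compact_space_def)
  qed
  then have "closedin X (\<Phi> ` topspace (disc n))"
    using cw_complexD(1)[OF cw] compactin_imp_closedin by blast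
  then have 1: "X closure_of c \<subseteq> \<Phi> ` topspace (disc n)"
    using surj by (intro closure_of_minimal) auto
  have "topspace (disc n) \<subseteq> disc n closure_of ?I"
  proof
    fix x assume x: "x \<in> topspace (disc n)"
    note lim = scaled_disc_limit[OF x]
    have "x \<in> closure ?I"
      unfolding closure_sequential 
      by (intro exI[of _ "\<lambda>k i. (1 - inverse (real (Suc k))) * x i"] conjI allI lim)
    then have "x \<in> topspace (disc n) \<inter> closure (topspace (disc n) \<inter> ?I)"
      using x by (simp add: Int_absorb1 Collect_subset)
    then show "x \<in> disc n closure_of ?I"
      by (subst disc_eq_top_of_set) (simp add: closure_of_subtopology)
  qed
  then have "\<Phi> ` topspace (disc n) \<subseteq> X closure_of (\<Phi> ` ?I)"
    using continuous_map_image_closure_subset[OF \<Phi>(1), of ?I] by blast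
  with 1 have "\<Phi> ` topspace (disc n) = X closure_of c" unfolding surj by auto
  with \<Phi>(1,3-) surj inj show ?thesis using that by blast
qed

lemma cw_cell_nonempty:
  assumes "cw_complex X cells" "c \<in> cells n"
  shows "c \<noteq> {}"
proof -
  obtain \<Phi> where "\<Phi> ` {x \<in> topspace (disc n). (\<Sum>i<n. (x i)\<^sup>2) < 1} = c"
    by (rule cw_characteristic_map[OF assms]) (rule that, assumption)
  moreover have "(\<lambda>_. 0) \<in> {x \<in> topspace (disc n). (\<Sum>i<n. (x i)\<^sup>2) < (1::real)}"
    by (simp add: topspace_disc)
  ultimately show ?thesis by blast
qed

lemma cw_closure_of_cell:
  assumes cw: "cw_complex X cells" and c: "c \<in> cells n" and x: "x \<in> X closure_of c" "x \<notin> c"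
  obtains m d where "m < n" "d \<in> cells m" "x \<in> d"
proof -
  obtain \<Phi> F where \<Phi>: "\<Phi> ` {x \<in> topspace (disc n). (\<Sum>i<n. (x i)\<^sup>2) < 1} = c"
    "\<Phi> ` topspace (disc n) = X closure_of c" "F \<subseteq> (\<Union>m<n. cells m)"
    "\<Phi> ` {x \<in> topspace (disc n). (\<Sum>i<n. (x i)\<^sup>2) = 1} \<subseteq> \<Union>F"
    by (rule cw_characteristic_map[OF cw c]) (rule that, assumption+)
  obtain z where z: "z \<in> topspace (disc n)" "x = \<Phi> z" using x(1) \<Phi>(2) by blast
  have "\<not> (\<Sum>i<n. (z i)\<^sup>2) < 1" using x(2) \<Phi>(1) z by blast
  then have "(\<Sum>i<n. (z i)\<^sup>2) = 1" using z(1) by (auto simp: topspace_disc)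
  then have "x \<in> \<Union>F" using \<Phi>(4) z by blast
  then show ?thesis using \<Phi>(3) that by blast
qed

text \<open>This is \<open>disc_extension_above\<close> transported along a characteristic map, with
  the pullbacks of \<open>f\<close> and \<open>h\<close> as data.\<close>

lemma cell_extension_above:
  fixes h :: "'x \<Rightarrow> 'm::metric_space"
  assumes C0: "CAT0 TYPE('m)" and ray: "geodesic_ray \<gamma>"
    and cw: "cw_complex X cells" and c: "c \<in> cells n"
    and f: "continuous_map X euclideanreal f" and surj: "\<And>x. x \<in> topspace X \<Longrightarrow> \<exists>q. busemann \<gamma> q = f x"
    and h: "\<And>m d. m < n \<Longrightarrow> d \<in> cells m \<Longrightarrow> continuous_map (subtopology X (X closure_of d)) euclidean h"
    and fh: "\<And>m d x. m < n \<Longrightarrow> d \<in> cells m \<Longrightarrow> x \<in> d \<Longrightarrow> f x \<le> busemann \<gamma> (h x)"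
  obtains H where "continuous_map (subtopology X (X closure_of c)) euclidean H"
    "\<And>x. x \<in> X closure_of c \<Longrightarrow> x \<notin> c \<Longrightarrow> H x = h x"
    "\<And>x. x \<in> c \<Longrightarrow> f x \<le> busemann \<gamma> (H x)"
    "\<exists>x0\<in>X closure_of c. (\<forall>x\<in>X closure_of c. f x0 \<le> f x) \<and> (x0 \<in> c \<longrightarrow> busemann \<gamma> (H x0) = f x0)"
proof -
  let ?S = "topspace (disc n)" and ?I = "{x \<in> topspace (disc n). (\<Sum>i<n. (x i)\<^sup>2) < 1}"
    and ?E = "{x \<in> topspace (disc n). (\<Sum>i<n. (x i)\<^sup>2) = 1}"
  obtain \<Phi> F where \<Phi>: "continuous_map (disc n) X \<Phi>" and I: "\<Phi> ` ?I = c" "inj_on \<Phi> ?I"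
    and S: "\<Phi> ` ?S = X closure_of c" and Ffin: "finite F" "F \<subseteq> (\<Union>m<n. cells m)" and E: "\<Phi> ` ?E \<subseteq> \<Union>F"
    using cw_characteristic_map[OF cw c] .
  have SIE: "z \<in> ?I \<or> z \<in> ?E" if "z \<in> ?S" for z using that by (auto simp: topspace_disc)
  have Ec: "\<Phi> z \<notin> c" if z: "z \<in> ?E" for z
  proof
    assume "\<Phi> z \<in> c"
    moreover obtain d m where "m < n" "d \<in> cells m" "\<Phi> z \<in> d" using E z Ffin(2) by blast
    ultimately show False using cw_complexD(3)[OF cw c] by blast
  qed
  let ?L = "\<Union>d\<in>F. X closure_of d"
  have FX: "d \<subseteq> X closure_of d" if "d \<in> F" for d
  proof -
    have "d \<subseteq> topspace X" using that Ffin(2) cw_complexD(2)[OF cw] by blast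
    then show ?thesis by (rule closure_of_subset)
  qed
  \<comment> \<open>The boundary of \<open>c\<close> meets only finitely many cells, so continuity
    on their closures can be glued.\<close>
  have hL: "continuous_map (subtopology X ?L) euclidean h"
    unfolding continuous_map_closedin
  proof (intro conjI allI impI)
    fix C :: "'m set" assume C: "closedin euclidean C"
    have "closedin X {x \<in> X closure_of d. h x \<in> C}" if d: "d \<in> F" for d
    proof -
      obtain m where "m < n" "d \<in> cells m" using d Ffin(2) by blast
      from closedin_continuous_map_preimage[OF h[OF this] C]
      have "closedin (subtopology X (X closure_of d)) {x \<in> X closure_of d. h x \<in> C}"
        by (simp add: Int_absorb1 closure_of_subset_topspace)
      then show ?thesis using closedin_closed_subtopology[OF closedin_closure_of] by blast
    qed
    then have "closedin X (\<Union>d\<in>F. {x \<in> X closure_of d. h x \<in> C})"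
      using Ffin(1) by (intro closedin_Union) auto
    then have "closedin X {x \<in> topspace (subtopology X ?L). h x \<in> C}"
      by (rule back_subst[of "closedin X"]) (use closure_of_subset_topspace[of X] in fastforce)
    then show "closedin (subtopology X ?L) {x \<in> topspace (subtopology X ?L). h x \<in> C}"
      by (rule closedin_subset_topspace) auto
  qed simp
  have "continuous_map (subtopology (disc n) ?E) (subtopology X ?L) \<Phi>"
  proof (rule continuous_map_into_subtopology)
    have "\<Phi> z \<in> ?L" if "z \<in> ?E" for z using that E FX by blast
    then show "\<Phi> \<in> topspace (subtopology (disc n) ?E) \<rightarrow> ?L" by auto
  qed (intro continuous_map_from_subtopology \<Phi>)
  then have "continuous_map (subtopology (disc n) ?E) euclidean (\<lambda>z. h (\<Phi> z))"
    using continuous_map_compose[OF _ hL] by (simp add: o_def)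
  then have hE: "continuous_on ?E (\<lambda>z. h (\<Phi> z))"
    by (subst (asm) disc_eq_top_of_set) (simp add: subtopology_subtopology Int_absorb1 Collect_subset)
  have "continuous_map (disc n) euclideanreal (\<lambda>z. f (\<Phi> z))"
    using continuous_map_compose[OF \<Phi> f] by (simp add: o_def)
  then have fS: "continuous_on ?S (\<lambda>z. f (\<Phi> z))" by (simp add: continuous_map_disc_iff)
  have zero: "(\<lambda>_. 0) \<in> ?I" by (simp add: topspace_disc)
  then have "?S \<noteq> {}" by blast
  from continuous_attains_inf[OF compact_disc this fS]
  obtain y0 where y0: "y0 \<in> ?S" "\<And>z. z \<in> ?S \<Longrightarrow> f (\<Phi> y0) \<le> f (\<Phi> z)" by blast
  \<comment> \<open>\<open>disc_extension_above\<close> asks for an interior point. If the minimum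
    was found on the sphere, no height has to be attained in \<open>c\<close>, and the centre serves
    as a default.\<close>
  define y where "y = (if y0 \<in> ?I then y0 else (\<lambda>_. 0))"
  have yI: "y \<in> ?I" using zero by (simp add: y_def)
  then have "\<Phi> y \<in> topspace X" using \<Phi> by (auto simp: continuous_map_def)
  then obtain q where q: "busemann \<gamma> q = f (\<Phi> y)" using surj by blast
  have above: "f (\<Phi> z) \<le> busemann \<gamma> (h (\<Phi> z))" if "z \<in> ?S" "(\<Sum>i<n. (z i)\<^sup>2) = 1" for z
  proof -
    have "\<Phi> z \<in> \<Phi> ` ?E" using that by simp
    then obtain d where d: "d \<in> F" "\<Phi> z \<in> d" using E by auto
    then obtain m where "m < n" "d \<in> cells m" using Ffin(2) by auto
    then show ?thesis using d(2) by (rule fh)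
  qed
  obtain K where K: "continuous_on ?S K" "\<And>x. x \<in> ?S \<Longrightarrow> (\<Sum>i<n. (x i)\<^sup>2) = 1 \<Longrightarrow> K x = h (\<Phi> x)"
    "\<And>x. x \<in> ?S \<Longrightarrow> f (\<Phi> x) \<le> busemann \<gamma> (K x)" "busemann \<gamma> (K y) = f (\<Phi> y)"
    using disc_extension_above[OF C0 ray fS hE above _ _ q] yI by blast
  define H where "H = (\<lambda>x. if x \<in> c then K (inv_into ?I \<Phi> x) else h x)"
  have H\<Phi>: "H (\<Phi> z) = K z" if z: "z \<in> ?S" for z
  proof (cases "z \<in> ?I")
    case True
    then have "\<Phi> z \<in> c" using I(1) by blast
    then show ?thesis using True I(2) by (simp add: H_def)
  next
    case False
    then have "z \<in> ?E" using SIE z by blast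
    then show ?thesis using Ec[of z] K(2)[of z] by (simp add: H_def)
  qed
  have "continuous_map (subtopology X (X closure_of c)) euclidean H"
    unfolding continuous_map_closedin
  proof (intro conjI allI impI)
    fix C :: "'m set" assume C: "closedin euclidean C"
    \<comment> \<open>A characteristic map is closed, being a map from a compact space to a
      Hausdorff space; hence continuity can be tested on the disc.\<close>
    have eq: "{x \<in> topspace (subtopology X (X closure_of c)). H x \<in> C} = \<Phi> ` {z \<in> ?S. K z \<in> C}"
      using S H\<Phi> closure_of_subset_topspace[of X c] by (force simp: image_iff)
    have "compact (?S \<inter> (K -` C \<inter> ?S))"
      using K(1) C compact_disc continuous_on_closed_vimage[of ?S K] compact_imp_closed
      by (intro compact_Int_closed) auto
    then have "compactin (disc n) {z \<in> ?S. K z \<in> C}"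
      by (subst disc_eq_top_of_set) (auto simp: compactin_subtopology Collect_conj_eq vimage_def Int_commute)
    then have "compactin X (\<Phi> ` {z \<in> ?S. K z \<in> C})" using \<Phi> by (rule image_compactin)
    then have "closedin X (\<Phi> ` {z \<in> ?S. K z \<in> C})"
      using cw_complexD(1)[OF cw] compactin_imp_closedin by blast
    then show "closedin (subtopology X (X closure_of c)) {x \<in> topspace (subtopology X (X closure_of c)). H x \<in> C}"
      unfolding eq by (rule closedin_subset_topspace) (use S in auto)
  qed simp
  moreover have "H x = h x" if "x \<notin> c" for x using that by (simp add: H_def)
  moreover have "f x \<le> busemann \<gamma> (H x)" if "x \<in> c" for x
  proof -
    have "x \<in> \<Phi> ` ?I" using I(1) that by simp
    then obtain z where "x = \<Phi> z" "z \<in> ?I" by (rule imageE)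
    then show ?thesis using K(3)[of z] H\<Phi>[of z] by simp
  qed
  moreover have "\<exists>x0\<in>X closure_of c. (\<forall>x\<in>X closure_of c. f x0 \<le> f x) \<and> (x0 \<in> c \<longrightarrow> busemann \<gamma> (H x0) = f x0)"
  proof (intro bexI conjI ballI impI)
    show "\<Phi> y0 \<in> X closure_of c" unfolding S[symmetric] by (rule imageI) (fact y0(1))
    fix x assume "x \<in> X closure_of c"
    then obtain z where "x = \<Phi> z" "z \<in> ?S" unfolding S[symmetric] by (rule imageE)
    then show "f (\<Phi> y0) \<le> f x" using y0(2) by simp
  next
    assume "\<Phi> y0 \<in> c"
    then have "y0 \<in> ?I" using Ec[of y0] SIE[OF y0(1)] by argo
    then have "y = y0" unfolding y_def by simp
    then show "busemann \<gamma> (H (\<Phi> y0)) = f (\<Phi> y0)" using K(4) H\<Phi>[OF y0(1)] by simp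
  qed
  ultimately show ?thesis using that by blast
qed

text \<open>The closure of a cell of positive dimension contains the image of a sphere point, which
  lies in a lower cell. By disjointness that cell is one of the cells of the subcomplex, and the
  descent ends in dimension 0.\<close>

lemma subcomplex_contains_0_cell:
  assumes cw: "cw_complex X cells" and A: "subcomplex X cells A" "A \<noteq> {}"
  shows "\<exists>c\<in>cells 0. c \<subseteq> A"
proof -
  obtain F where F: "F \<subseteq> (\<Union>n. cells n)" "A = \<Union>F" "\<And>c. c \<in> F \<Longrightarrow> X closure_of c \<subseteq> A"
    using A(1) unfolding subcomplex_def by blast
  have "c \<in> F \<Longrightarrow> c \<in> cells n \<Longrightarrow> \<exists>d\<in>F. d \<in> cells 0" for n c
  proof (induction n arbitrary: c rule: less_induct)
    case (less n)
    show ?case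
    proof (cases "n = 0")
      case False
      obtain \<Phi> K where \<Phi>: "\<Phi> ` topspace (disc n) = X closure_of c" "K \<subseteq> (\<Union>m<n. cells m)"
        "\<Phi> ` {x \<in> topspace (disc n). (\<Sum>i<n. (x i)\<^sup>2) = 1} \<subseteq> \<Union>K"
        by (rule cw_characteristic_map[OF cw less.prems(2)]) (rule that, assumption+)
      define z :: "nat \<Rightarrow> real" where "z = (\<lambda>i. if i = 0 then 1 else 0)"
      have "(\<Sum>i<n. (z i)\<^sup>2) = (\<Sum>i<n. if i = 0 then 1 else 0)" by (rule sum.cong) (auto simp: z_def)
      then have z: "(\<Sum>i<n. (z i)\<^sup>2) = 1" using False by simp
      then have zD: "z \<in> topspace (disc n)" using False by (simp add: topspace_disc z_def)
      have "\<Phi> z \<in> \<Phi> ` {x \<in> topspace (disc n). (\<Sum>i<n. (x i)\<^sup>2) = 1}" using z zD by simp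
      then obtain d where d: "d \<in> K" "\<Phi> z \<in> d" using \<Phi>(3) by auto
      then obtain m where m: "m < n" "d \<in> cells m" using \<Phi>(2) by auto
      have "\<Phi> z \<in> X closure_of c" unfolding \<Phi>(1)[symmetric] using zD by (rule imageI)
      then have "\<Phi> z \<in> \<Union>F" using F(2,3) less.prems(1) by auto
      then obtain d' where d': "d' \<in> F" "\<Phi> z \<in> d'" by auto
      then obtain m' where m': "d' \<in> cells m'" using F(1) by auto
      have "d = d'" using cw_complexD(3)[OF cw m(2) m' d(2) d'(2)] by simp
      then show ?thesis using less.IH[OF m(1)] d'(1) m(2) by blast
    qed (use less.prems in auto)
  qed
  moreover obtain c where "c \<in> F" using A(2) F(2) by auto
  moreover from this obtain n where "c \<in> cells n" using F(1) by auto
  ultimately show ?thesis using F(2) by blast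
qed

text \<open>Preimages of horoballs under two maps may differ, as long as they contain the same
  subcomplexes.\<close>

lemma largest_subcomplex_cong:
  assumes "\<And>A. subcomplex X cells A \<Longrightarrow> A \<subseteq> S \<longleftrightarrow> A \<subseteq> T"
  shows "largest_subcomplex X cells S = largest_subcomplex X cells T"
  using assms unfolding largest_subcomplex_def by metis

section \<open>Equivariant maps with prescribed heights\<close>

text \<open>\<open>f\<close> is the height to be realized by a map to \<open>M\<close>. It and the
  Busemann function change under \<open>G\<close> by the same \<open>\<kappa>\<close>, so
  comparisons between them need to be arranged only on one cell of each orbit.\<close>

locale equivariant_height =
  fixes G :: "('g, 'b) monoid_scheme" and X :: "'x topology" and cells :: "nat \<Rightarrow> 'x set set"
    and \<alpha> :: "'g \<Rightarrow> 'x \<Rightarrow> 'x" and \<rho> :: "'g \<Rightarrow> 'm::metric_space \<Rightarrow> 'm" and \<gamma> :: "real \<Rightarrow> 'm"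
    and f :: "'x \<Rightarrow> real" and \<kappa> :: "'g \<Rightarrow> real"
  assumes grp: "group G" and gcw: "G_cw_complex G X cells \<alpha>" and free: "free_action G (topspace X) \<alpha>"
    and C0: "CAT0 TYPE('m)" and ray: "geodesic_ray \<gamma>" and iso: "isometric_action G \<rho>"
    and cont_f: "continuous_map X euclideanreal f"
    and f_action: "g \<in> carrier G \<Longrightarrow> x \<in> topspace X \<Longrightarrow> f (\<alpha> g x) = f x + \<kappa> g"
    and busemann_shift: "g \<in> carrier G \<Longrightarrow> busemann \<gamma> (\<rho> g a) = busemann \<gamma> a + \<kappa> g"
    and surj: "x \<in> topspace X \<Longrightarrow> \<exists>q. busemann \<gamma> q = f x"
begin

section \<open>The action on cells and their closures\<close>

sublocale group G by (rule grp)

lemma cw: "cw_complex X cells" using gcw by (simp add: G_cw_complex_def)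

lemma actX: "group_action G (topspace X) \<alpha>" using gcw by (simp add: G_cw_complex_def)

lemma act_mult: "g \<in> carrier G \<Longrightarrow> h \<in> carrier G \<Longrightarrow> x \<in> topspace X \<Longrightarrow> \<alpha> (g \<otimes>\<^bsub>G\<^esub> h) x = \<alpha> g (\<alpha> h x)"
  using group_action.composition_rule[OF actX] by blast

lemma act_one: "x \<in> topspace X \<Longrightarrow> \<alpha> \<one>\<^bsub>G\<^esub> x = x"
  using group_action.id_eq_one[OF actX] by (metis restrict_apply)

lemma act_inv: "g \<in> carrier G \<Longrightarrow> x \<in> topspace X \<Longrightarrow> \<alpha> (inv\<^bsub>G\<^esub> g) (\<alpha> g x) = x"
  "g \<in> carrier G \<Longrightarrow> x \<in> topspace X \<Longrightarrow> \<alpha> g (\<alpha> (inv\<^bsub>G\<^esub> g) x) = x"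
  by (simp_all add: act_one flip: act_mult)

lemma cell_subset: "c \<in> cells n \<Longrightarrow> c \<subseteq> topspace X"
  using cw_complexD(2)[OF cw] by blast

lemma closure_subset: "c \<in> cells n \<Longrightarrow> x \<in> c \<Longrightarrow> x \<in> X closure_of c"
  using closure_of_subset[OF cell_subset] by blast

lemma closure_topspace: "x \<in> X closure_of c \<Longrightarrow> x \<in> topspace X"
  using closure_of_subset_topspace[of X c] by blast

lemma cell_image: "g \<in> carrier G \<Longrightarrow> c \<in> cells n \<Longrightarrow> \<alpha> g ` c \<in> cells n"
  using gcw unfolding G_cw_complex_def by blast

lemma act_continuous: "g \<in> carrier G \<Longrightarrow> continuous_map X X (\<alpha> g)"
  using gcw unfolding G_cw_complex_def by blast

lemma closure_image:
  assumes "g \<in> carrier G" "c \<in> cells n"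
  shows "X closure_of (\<alpha> g ` c) = \<alpha> g ` (X closure_of c)"
proof -
  have "homeomorphic_maps X X (\<alpha> g) (\<alpha> (inv\<^bsub>G\<^esub> g))"
    unfolding homeomorphic_maps_def using assms(1) by (auto simp: act_continuous act_inv)
  then show ?thesis
    using homeomorphic_map_closure_of[of X X "\<alpha> g" c] cell_subset[OF assms(2)] homeomorphic_maps_imp_map by blast
qed

text \<open>An element that maps a cell to itself fixes it pointwise, so freeness on points passes
  to cells. Translating elements between cells are therefore unique.\<close>

lemma translate_cell_cancel:
  assumes "c \<in> cells n" "g \<in> carrier G" "h \<in> carrier G" "\<alpha> g ` c = \<alpha> h ` c"
  shows "g = h"
proof -
  let ?k = "inv\<^bsub>G\<^esub> h \<otimes>\<^bsub>G\<^esub> g"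
  have k: "?k \<in> carrier G" using assms by simp
  have cX: "x \<in> topspace X" if "x \<in> c" for x using that cell_subset[OF assms(1)] by blast
  have "\<alpha> ?k ` c = \<alpha> (inv\<^bsub>G\<^esub> h) ` \<alpha> g ` c"
    using assms(2,3) cX by (auto simp: act_mult image_image)
  also have "\<dots> = (\<lambda>x. x) ` c"
    unfolding assms(4) image_image using assms(3) cX by (intro image_cong) (auto simp: act_inv)
  finally have "\<alpha> ?k ` c = c" by simp
  then have fixed: "\<forall>x\<in>c. \<alpha> ?k x = x" using gcw k assms(1) unfolding G_cw_complex_def by blast
  obtain x where x: "x \<in> c" using cw_cell_nonempty[OF cw assms(1)] by blast
  have "?k \<in> stabilizer G \<alpha> x" using fixed x k by (simp add: stabilizer_def)
  then have "?k = \<one>\<^bsub>G\<^esub>" using free cX[OF x] by (auto simp: free_action_def)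
  then have "h \<otimes>\<^bsub>G\<^esub> ?k = h" using assms(3) by simp
  then show ?thesis using assms(2,3) by (simp flip: m_assoc)
qed

text \<open>If \<open>x0\<close> does not lie in \<open>c\<close>, it lies in a cell of lower dimension, to which the same condition
  applies. Hence a subcomplex does not reach lower under \<open>f\<close> than it does under the height of \<open>h\<close>.\<close>

definition tight :: "'x set \<Rightarrow> ('x \<Rightarrow> 'm) \<Rightarrow> bool" where
  "tight c h \<longleftrightarrow> continuous_map (subtopology X (X closure_of c)) euclidean h \<and>
     (\<forall>x\<in>c. f x \<le> busemann \<gamma> (h x)) \<and>
     (\<exists>x0\<in>X closure_of c. (\<forall>x\<in>X closure_of c. f x0 \<le> f x) \<and> (x0 \<in> c \<longrightarrow> busemann \<gamma> (h x0) = f x0))"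

lemma tight_cong:
  assumes c: "c \<in> cells n" and eq: "\<And>x. x \<in> X closure_of c \<Longrightarrow> h x = h' x" and t: "tight c h"
  shows "tight c h'"
proof -
  obtain x0 where x0: "x0 \<in> X closure_of c" "\<forall>x\<in>X closure_of c. f x0 \<le> f x"
    "x0 \<in> c \<longrightarrow> busemann \<gamma> (h x0) = f x0"
    using t unfolding tight_def by blast
  show ?thesis unfolding tight_def
  proof (intro conjI bexI[of _ x0] ballI)
    show "continuous_map (subtopology X (X closure_of c)) euclidean h'"
      by (rule continuous_map_eq[of _ _ h]) (use t eq in \<open>auto simp: tight_def\<close>)
    show "f x \<le> busemann \<gamma> (h' x)" if "x \<in> c" for x
      using t that eq[OF closure_subset[OF c that]] by (auto simp: tight_def)
    show "x0 \<in> c \<longrightarrow> busemann \<gamma> (h' x0) = f x0" using x0 eq by metis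
  qed (use x0 in auto)
qed

text \<open>Under conjugation by \<open>g\<close> the height of the map and \<open>f\<close> both
  shift by \<open>\<kappa> g\<close>, which keeps inequalities, minima and equalities.\<close>

lemma tight_translate:
  assumes c: "c \<in> cells n" and g: "g \<in> carrier G" and t: "tight c h"
  shows "tight (\<alpha> g ` c) (\<lambda>x. \<rho> g (h (\<alpha> (inv\<^bsub>G\<^esub> g) x)))"
proof -
  let ?h = "\<lambda>x. \<rho> g (h (\<alpha> (inv\<^bsub>G\<^esub> g) x))"
  note cl = closure_image[OF g c]
  have ht: "busemann \<gamma> (?h (\<alpha> g x)) = busemann \<gamma> (h x) + \<kappa> g" "f (\<alpha> g x) = f x + \<kappa> g"
    if "x \<in> X closure_of c" for x
    using that closure_topspace g by (simp_all add: busemann_shift f_action act_inv)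
  obtain x0 where x0: "x0 \<in> X closure_of c" "\<forall>x\<in>X closure_of c. f x0 \<le> f x"
    "x0 \<in> c \<longrightarrow> busemann \<gamma> (h x0) = f x0"
    using t unfolding tight_def by blast
  show ?thesis unfolding tight_def
  proof (intro conjI bexI[of _ "\<alpha> g x0"])
    have "continuous_map (subtopology X (X closure_of (\<alpha> g ` c))) (subtopology X (X closure_of c)) (\<alpha> (inv\<^bsub>G\<^esub> g))"
    proof (rule continuous_map_into_subtopology)
      show "continuous_map (subtopology X (X closure_of (\<alpha> g ` c))) X (\<alpha> (inv\<^bsub>G\<^esub> g))"
        using g by (intro continuous_map_from_subtopology act_continuous) simp
      show "\<alpha> (inv\<^bsub>G\<^esub> g) \<in> topspace (subtopology X (X closure_of (\<alpha> g ` c))) \<rightarrow> X closure_of c"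
        unfolding cl using g closure_topspace by (auto simp: act_inv)
    qed
    moreover have "continuous_map (subtopology X (X closure_of c)) euclidean h" using t by (simp add: tight_def)
    ultimately have "continuous_map (subtopology X (X closure_of (\<alpha> g ` c))) euclidean (h \<circ> \<alpha> (inv\<^bsub>G\<^esub> g))"
      by (rule continuous_map_compose)
    moreover have "continuous_on UNIV (\<rho> g)"
      by (rule lipschitz_on_continuous_on[of 1], rule lipschitz_onI) (simp_all add: isometric_actionD(1)[OF iso g])
    then have "continuous_map euclidean euclidean (\<rho> g)" by simp
    ultimately have "continuous_map (subtopology X (X closure_of (\<alpha> g ` c))) euclidean (\<rho> g \<circ> (h \<circ> \<alpha> (inv\<^bsub>G\<^esub> g)))"
      by (rule continuous_map_compose)
    then show "continuous_map (subtopology X (X closure_of (\<alpha> g ` c))) euclidean ?h"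
      by (simp only: o_def)
    show "\<forall>x\<in>\<alpha> g ` c. f x \<le> busemann \<gamma> (?h x)"
    proof
      fix x assume "x \<in> \<alpha> g ` c"
      then obtain y where y: "x = \<alpha> g y" "y \<in> c" by blast
      then show "f x \<le> busemann \<gamma> (?h x)" using ht[OF closure_subset[OF c y(2)]] t by (simp add: tight_def)
    qed
    show "\<forall>x\<in>X closure_of (\<alpha> g ` c). f (\<alpha> g x0) \<le> f x"
      unfolding cl using x0 ht(2) by simp
    show "\<alpha> g x0 \<in> \<alpha> g ` c \<longrightarrow> busemann \<gamma> (?h (\<alpha> g x0)) = f (\<alpha> g x0)"
    proof
      assume "\<alpha> g x0 \<in> \<alpha> g ` c"
      then obtain y where y: "\<alpha> g x0 = \<alpha> g y" "y \<in> c" by blast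
      then have "x0 = y" using g act_inv(1) closure_topspace[OF x0(1)] cell_subset[OF c] by (metis subsetD)
      then show "busemann \<gamma> (?h (\<alpha> g x0)) = f (\<alpha> g x0)" using x0 y ht by simp
    qed
    show "\<alpha> g x0 \<in> X closure_of (\<alpha> g ` c)" unfolding cl using x0(1) by (rule imageI)
  qed
qed

text \<open>Only cells of dimension less than \<open>n\<close> are controlled. So
  \<open>good 0\<close> holds for every function and starts the induction.\<close>

definition good :: "nat \<Rightarrow> ('x \<Rightarrow> 'm) \<Rightarrow> bool" where
  "good n h \<longleftrightarrow> (\<forall>m<n. \<forall>c\<in>cells m. tight c h \<and> (\<forall>g\<in>carrier G. \<forall>x\<in>c. h (\<alpha> g x) = \<rho> g (h x)))"

lemma goodD:
  assumes "good n h" "m < n" "c \<in> cells m"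
  shows "tight c h" "g \<in> carrier G \<Longrightarrow> x \<in> c \<Longrightarrow> h (\<alpha> g x) = \<rho> g (h x)"
  using assms by (auto simp: good_def)

lemma cell_extension_tight:
  assumes "good n h" "c \<in> cells n"
  shows "\<exists>H. tight c H \<and> (\<forall>x\<in>X closure_of c. x \<notin> c \<longrightarrow> H x = h x)"
proof (rule cell_extension_above[OF C0 ray cw assms(2) cont_f surj, of h])
  show "continuous_map (subtopology X (X closure_of d)) euclidean h" if "m < n" "d \<in> cells m" for m d
    using goodD(1)[OF assms(1) that] by (simp add: tight_def)
  show "f x \<le> busemann \<gamma> (h x)" if "m < n" "d \<in> cells m" "x \<in> d" for m d x
    using goodD(1)[OF assms(1) that(1,2)] that(3) by (simp add: tight_def)
  fix H assume "continuous_map (subtopology X (X closure_of c)) euclidean H"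
    "\<And>x. x \<in> X closure_of c \<Longrightarrow> x \<notin> c \<Longrightarrow> H x = h x" "\<And>x. x \<in> c \<Longrightarrow> f x \<le> busemann \<gamma> (H x)"
    "\<exists>x0\<in>X closure_of c. (\<forall>x\<in>X closure_of c. f x0 \<le> f x) \<and> (x0 \<in> c \<longrightarrow> busemann \<gamma> (H x0) = f x0)"
  then show ?thesis unfolding tight_def by (intro exI[of _ H] conjI ballI impI) simp_all
qed

text \<open>The extension over one representative of each orbit of \<open>n\<close>-cells is carried
  to the other cells of the orbit by the unique translating elements.\<close>

lemma extend_to_skeleton:
  assumes h: "good n h"
  shows "\<exists>h'. good (Suc n) h' \<and> (\<forall>m<n. \<forall>c\<in>cells m. \<forall>x\<in>c. h' x = h x)"
proof -
  define orb where "orb c = {\<alpha> g ` c |g. g \<in> carrier G}" for c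
  \<comment> \<open>The choice is made from the orbit as a set, so all cells of an orbit share one
    representative.\<close>
  define R where "R c = (SOME d. d \<in> orb c)" for c
  define t where "t c = (SOME g. g \<in> carrier G \<and> \<alpha> g ` R c = c)" for c
  have image_mult: "\<alpha> g ` \<alpha> k ` c = \<alpha> (g \<otimes>\<^bsub>G\<^esub> k) ` c" if "g \<in> carrier G" "k \<in> carrier G" "c \<in> cells n" for g k c
    unfolding image_image using that cell_subset[OF that(3)] by (intro image_cong) (auto simp: act_mult)
  have image_one: "\<alpha> \<one>\<^bsub>G\<^esub> ` c = c" if "c \<in> cells n" for c
    using cell_subset[OF that] act_one by (force simp: image_iff)
  have "c \<in> orb c" if "c \<in> cells n" for c
    using image_one[OF that] unfolding orb_def by blast
  then have Rorb: "R c \<in> orb c" if "c \<in> cells n" for c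
    unfolding R_def using that by (intro someI)
  have Rcell: "R c \<in> cells n" if "c \<in> cells n" for c
    using Rorb[OF that] cell_image[OF _ that] by (auto simp: orb_def)
  have t: "t c \<in> carrier G \<and> \<alpha> (t c) ` R c = c" if c: "c \<in> cells n" for c
  proof -
    obtain g where g: "g \<in> carrier G" "R c = \<alpha> g ` c" using Rorb[OF c] by (auto simp: orb_def)
    then have "\<alpha> (inv\<^bsub>G\<^esub> g) ` R c = c"
      using c by (simp add: image_mult image_one)
    then have "\<exists>g. g \<in> carrier G \<and> \<alpha> g ` R c = c" using g(1) by blast
    then show ?thesis unfolding t_def by (rule someI_ex)
  qed
  have R_image: "R (\<alpha> g ` c) = R c" if g: "g \<in> carrier G" and c: "c \<in> cells n" for g c
  proof -
    have "\<alpha> k ` \<alpha> g ` c \<in> orb c" if "k \<in> carrier G" for k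
      using image_mult[OF that g c] that g by (auto simp: orb_def)
    moreover have "\<alpha> k ` c \<in> orb (\<alpha> g ` c)" if k: "k \<in> carrier G" for k
    proof -
      have "\<alpha> (k \<otimes>\<^bsub>G\<^esub> inv\<^bsub>G\<^esub> g) ` \<alpha> g ` c = \<alpha> k ` c"
        using k g c by (simp add: image_mult m_assoc)
      moreover have "k \<otimes>\<^bsub>G\<^esub> inv\<^bsub>G\<^esub> g \<in> carrier G" using k g by simp
      ultimately show ?thesis unfolding orb_def by blast
    qed
    ultimately have "orb (\<alpha> g ` c) = orb c" by (auto simp: orb_def[of "\<alpha> g ` c"] orb_def[of c])
    then show ?thesis by (simp add: R_def)
  qed
  \<comment> \<open>This rule makes \<open>K\<close> equivariant; it rests on the uniqueness of the
    translating element.\<close>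
  have t_image: "t (\<alpha> g ` c) = g \<otimes>\<^bsub>G\<^esub> t c" if g: "g \<in> carrier G" and c: "c \<in> cells n" for g c
  proof (rule translate_cell_cancel[OF Rcell[OF c]])
    show "t (\<alpha> g ` c) \<in> carrier G" "g \<otimes>\<^bsub>G\<^esub> t c \<in> carrier G"
      using t[OF c] t[OF cell_image[OF g c]] g by simp_all
    show "\<alpha> (t (\<alpha> g ` c)) ` R c = \<alpha> (g \<otimes>\<^bsub>G\<^esub> t c) ` R c"
      using t[OF c] t[OF cell_image[OF g c]] g R_image[OF g c] image_mult[OF g _ Rcell[OF c], of "t c"] by simp
  qed
  obtain Hf where Hf: "\<And>c. c \<in> cells n \<Longrightarrow> tight c (Hf c)"
    "\<And>c x. c \<in> cells n \<Longrightarrow> x \<in> X closure_of c \<Longrightarrow> x \<notin> c \<Longrightarrow> Hf c x = h x"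
    using cell_extension_tight[OF h] by metis
  define K where "K c x = \<rho> (t c) (Hf (R c) (\<alpha> (inv\<^bsub>G\<^esub> (t c)) x))" for c x
  have K_tight: "tight c (K c)" if c: "c \<in> cells n" for c
    using tight_translate[OF Rcell[OF c] _ Hf(1)[OF Rcell[OF c]], of "t c"] t[OF c] by (simp add: K_def[abs_def])
  \<comment> \<open>\<open>h\<close> is already equivariant on lower cells, so translating its
    values reproduces \<open>h\<close>.\<close>
  have K_boundary: "K c x = h x" if c: "c \<in> cells n" and x: "x \<in> X closure_of c" "x \<notin> c" for c x
  proof -
    have "x \<in> \<alpha> (t c) ` (X closure_of R c)"
      using closure_image[of "t c" "R c" n] t[OF c] Rcell[OF c] x(1) by simp
    then obtain y where y: "x = \<alpha> (t c) y" "y \<in> X closure_of R c" by (rule imageE)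
    have "y \<notin> R c" using y(1) x(2) t[OF c] by blast
    then obtain m d where m: "m < n" "d \<in> cells m" "y \<in> d" using cw_closure_of_cell[OF cw Rcell[OF c] y(2)] by blast
    have "K c x = \<rho> (t c) (Hf (R c) y)" unfolding K_def y(1) using t[OF c] closure_topspace[OF y(2)] by (simp add: act_inv)
    also have "\<dots> = \<rho> (t c) (h y)" using Hf(2)[OF Rcell[OF c] y(2) \<open>y \<notin> R c\<close>] by simp
    also have "\<dots> = h x" unfolding y(1) using goodD(2)[OF h m(1,2) _ m(3)] t[OF c] by simp
    finally show ?thesis .
  qed
  have K_action: "K (\<alpha> g ` c) (\<alpha> g x) = \<rho> g (K c x)" if g: "g \<in> carrier G" and c: "c \<in> cells n" and x: "x \<in> c" for g c x
  proof -
    have xX: "x \<in> topspace X" using cell_subset[OF c] x by blast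
    have tc: "t c \<in> carrier G" using t[OF c] by blast
    have "inv\<^bsub>G\<^esub> (g \<otimes>\<^bsub>G\<^esub> t c) \<otimes>\<^bsub>G\<^esub> g = inv\<^bsub>G\<^esub> (t c)"
      using g tc by (simp add: inv_mult_group m_assoc)
    then have "\<alpha> (inv\<^bsub>G\<^esub> (g \<otimes>\<^bsub>G\<^esub> t c)) (\<alpha> g x) = \<alpha> (inv\<^bsub>G\<^esub> (t c)) x"
      using act_mult[of "inv\<^bsub>G\<^esub> (g \<otimes>\<^bsub>G\<^esub> t c)" g x] g tc xX by simp
    then show ?thesis unfolding K_def t_image[OF g c] R_image[OF g c]
      using isometric_actionD(2)[OF iso g tc] by simp
  qed
  define h' where "h' x = (if \<exists>c\<in>cells n. x \<in> c then K (THE c. c \<in> cells n \<and> x \<in> c) x else h x)" for x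
  have h'_new: "h' x = K c x" if "c \<in> cells n" "x \<in> c" for c x
  proof -
    have "(THE c. c \<in> cells n \<and> x \<in> c) = c"
      using that cw_complexD(3)[OF cw] by (intro the_equality) blast+
    then show ?thesis using that by (auto simp: h'_def)
  qed
  have h'_old: "h' x = h x" if "m < n" "c \<in> cells m" "x \<in> c" for m c x
    using that cw_complexD(3)[OF cw that(2) _ that(3)] unfolding h'_def by (metis less_irrefl)
  have "good (Suc n) h'" unfolding good_def
  proof (intro allI impI ballI conjI)
    fix m c assume m: "m < Suc n" and c: "c \<in> cells m"
    show "tight c h'"
    proof (cases "m = n")
      case True
      with c have cn: "c \<in> cells n" by simp
      show ?thesis
      proof (rule tight_cong[OF cn _ K_tight[OF cn]])
        fix x assume x: "x \<in> X closure_of c"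
        show "K c x = h' x"
        proof (cases "x \<in> c")
          case False
          then obtain j d where "j < n" "d \<in> cells j" "x \<in> d" using cw_closure_of_cell[OF cw cn x] by blast
          then show ?thesis using K_boundary[OF cn x False] h'_old by simp
        qed (simp add: h'_new[OF cn])
      qed
    next
      case False
      with m have mn: "m < n" by simp
      show ?thesis
      proof (rule tight_cong[OF c _ goodD(1)[OF h mn c]])
        fix x assume x: "x \<in> X closure_of c"
        show "h x = h' x"
        proof (cases "x \<in> c")
          case False
          then obtain j d where "j < m" "d \<in> cells j" "x \<in> d" using cw_closure_of_cell[OF cw c x] by blast
          then show ?thesis using h'_old[of j d x] mn by simp
        qed (simp add: h'_old[OF mn c])
      qed
    qed
    fix g x assume g: "g \<in> carrier G" and x: "x \<in> c"
    show "h' (\<alpha> g x) = \<rho> g (h' x)"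
    proof (cases "m = n")
      case True
      with c have cn: "c \<in> cells n" by simp
      show ?thesis
        using h'_new[OF cn x] h'_new[OF cell_image[OF g cn]] K_action[OF g cn x] x by simp
    next
      case False
      with m have mn: "m < n" by simp
      show ?thesis
        using h'_old[OF mn c x] h'_old[OF mn cell_image[OF g c]] goodD(2)[OF h mn c g x] x by simp
    qed
  qed
  then show ?thesis using h'_old by blast
qed

text \<open>On an \<open>m\<close>-cell the maps for successive skeleta no longer change from stage
  \<open>Suc m\<close> on, which defines their limit.\<close>

lemma good_map_exists: "\<exists>h. \<forall>n. good n h"
proof -
  have "\<exists>hs. \<forall>n. good n (hs n) \<and> (\<forall>m<n. \<forall>c\<in>cells m. \<forall>x\<in>c. hs (Suc n) x = hs n x)"
    by (rule dependent_nat_choice) (use extend_to_skeleton in \<open>auto simp: good_def\<close>)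
  then obtain hs where hs: "\<And>n. good n (hs n)"
    and step: "\<And>n m c x. m < n \<Longrightarrow> c \<in> cells m \<Longrightarrow> x \<in> c \<Longrightarrow> hs (Suc n) x = hs n x" by blast
  have stable: "hs n x = hs (Suc m) x" if "m < n" "c \<in> cells m" "x \<in> c" for n m c x
    using that(1)
  proof (induction n)
    case (Suc n)
    show ?case
    proof (cases "m = n")
      case False
      then show ?thesis using Suc step[of m n c x] that(2,3) by simp
    qed simp
  qed simp
  define h where "h x = hs (Suc (THE m. \<exists>c\<in>cells m. x \<in> c)) x" for x
  have h: "h x = hs n x" if "m < n" "c \<in> cells m" "x \<in> c" for n m c x
  proof -
    have "(THE m. \<exists>c\<in>cells m. x \<in> c) = m"
      using that(2,3) cw_complexD(3)[OF cw] by (intro the_equality) blast+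
    then show ?thesis using stable[OF that] by (simp add: h_def)
  qed
  have "good n h" for n unfolding good_def
  proof (intro allI impI ballI conjI)
    fix m c assume m: "m < n" and c: "c \<in> cells m"
    show "tight c h"
    proof (rule tight_cong[OF c _ goodD(1)[OF hs lessI[of m] c]])
      fix x assume x: "x \<in> X closure_of c"
      show "hs (Suc m) x = h x"
      proof (cases "x \<in> c")
        case False
        then obtain j d where "j < m" "d \<in> cells j" "x \<in> d" using cw_closure_of_cell[OF cw c x] by blast
        then show ?thesis using h[of j "Suc m" d x] by simp
      qed (simp add: h[OF lessI c])
    qed
    fix g x assume g: "g \<in> carrier G" and x: "x \<in> c"
    show "h (\<alpha> g x) = \<rho> g (h x)"
      using h[OF lessI c x] h[OF lessI cell_image[OF g c]] goodD(2)[OF hs lessI[of m] c g x] x by simp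
  qed
  then show ?thesis by blast
qed

proposition height_preserving_map:
  obtains h where "continuous_map X euclidean h"
    "\<And>g x. g \<in> carrier G \<Longrightarrow> x \<in> topspace X \<Longrightarrow> h (\<alpha> g x) = \<rho> g (h x)"
    "\<And>s. largest_subcomplex X cells (h -` horoball \<gamma> s \<inter> topspace X) =
      largest_subcomplex X cells {x \<in> topspace X. s \<le> f x}"
proof -
  obtain h where h: "\<And>n. good n h" using good_map_exists by blast
  note tight = goodD(1)[OF h lessI]
  have "continuous_map X euclidean h" unfolding continuous_map_closedin
  proof (intro conjI allI impI)
    fix C :: "'m set" assume C: "closedin euclidean C"
    show "closedin X {x \<in> topspace X. h x \<in> C}"
    \<comment> \<open>By the weak topology it suffices to look at closed cells.\<close>
    proof (rule cw_complexD(4)[OF cw])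
      fix n c assume "c \<in> cells n"
      from tight[OF this] have "continuous_map (subtopology X (X closure_of c)) euclidean h" by (simp add: tight_def)
      from closedin_continuous_map_preimage[OF this C]
      have "closedin X {x \<in> topspace (subtopology X (X closure_of c)). h x \<in> C}"
        using closedin_closed_subtopology[OF closedin_closure_of[of X c]] by blast
      then show "closedin X ({x \<in> topspace X. h x \<in> C} \<inter> X closure_of c)"
        by (rule back_subst[of "closedin X"]) auto
    qed auto
  qed simp
  moreover have "h (\<alpha> g x) = \<rho> g (h x)" if g: "g \<in> carrier G" and x: "x \<in> topspace X" for g x
  proof -
    obtain n c where "c \<in> cells n" "x \<in> c" using x cw_complexD(2)[OF cw] by auto
    then show ?thesis using goodD(2)[OF h lessI] g by blast
  qed
  moreover have "largest_subcomplex X cells (h -` horoball \<gamma> s \<inter> topspace X) =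
      largest_subcomplex X cells {x \<in> topspace X. s \<le> f x}" for s
  proof (rule largest_subcomplex_cong)
    fix A assume "subcomplex X cells A"
    then obtain F where F: "F \<subseteq> (\<Union>n. cells n)" "A = \<Union>F" "\<And>c. c \<in> F \<Longrightarrow> X closure_of c \<subseteq> A"
      unfolding subcomplex_def by blast
    have cellF: "\<exists>n c. c \<in> F \<and> c \<in> cells n \<and> x \<in> c" if "x \<in> A" for x
    proof -
      obtain c where c: "c \<in> F" "x \<in> c" using \<open>x \<in> A\<close> F(2) by auto
      then obtain n where "c \<in> cells n" using F(1) by auto
      with c show ?thesis by blast
    qed
    have AX: "x \<in> topspace X" if "x \<in> A" for x using cellF[OF that] cell_subset by blast
    show "A \<subseteq> h -` horoball \<gamma> s \<inter> topspace X \<longleftrightarrow> A \<subseteq> {x \<in> topspace X. s \<le> f x}"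
    proof
      assume A: "A \<subseteq> {x \<in> topspace X. s \<le> f x}"
      show "A \<subseteq> h -` horoball \<gamma> s \<inter> topspace X"
      proof
        fix x assume x: "x \<in> A"
        then obtain n c where c: "c \<in> cells n" "x \<in> c" using cellF by blast
        have "f x \<le> busemann \<gamma> (h x)" using tight[OF c(1)] c(2) by (simp add: tight_def)
        moreover have "s \<le> f x" using A x by blast
        ultimately show "x \<in> h -` horoball \<gamma> s \<inter> topspace X" using AX[OF x] by (simp add: horoball_def)
      qed
    next
      assume A: "A \<subseteq> h -` horoball \<gamma> s \<inter> topspace X"
      \<comment> \<open>Induction on the dimension: the minimizer \<open>x0\<close> of
        \<open>f\<close> on the closed cell either has height \<open>f x0\<close> or lies in a lower
        cell, which belongs to \<open>F\<close> by disjointness.\<close>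
      have "s \<le> f x" if "c \<in> F" "c \<in> cells n" "x \<in> c" for n c x
        using that
      proof (induction n arbitrary: c x rule: less_induct)
        case (less n)
        obtain x0 where x0: "x0 \<in> X closure_of c" "\<forall>x\<in>X closure_of c. f x0 \<le> f x"
          "x0 \<in> c \<longrightarrow> busemann \<gamma> (h x0) = f x0"
          using tight[OF less.prems(2)] unfolding tight_def by blast
        have x0A: "x0 \<in> A" using F(3)[OF less.prems(1)] x0(1) by blast
        have "s \<le> f x0"
        proof (cases "x0 \<in> c")
          case True
          then show ?thesis using x0(3) A x0A by (auto simp: horoball_def)
        next
          case False
          then obtain m d where m: "m < n" "d \<in> cells m" "x0 \<in> d"
            using cw_closure_of_cell[OF cw less.prems(2) x0(1)] by blast
          obtain j d' where d': "d' \<in> F" "d' \<in> cells j" "x0 \<in> d'" using cellF[OF x0A] by blast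
          then have "d = d'" using cw_complexD(3)[OF cw m(2) d'(2) m(3)] by blast
          then show ?thesis using less.IH[OF m(1) _ m(2,3)] d'(1) by blast
        qed
        also have "f x0 \<le> f x" using x0(2) closure_subset[OF less.prems(2,3)] by blast
        finally show ?case .
      qed
      then show "A \<subseteq> {x \<in> topspace X. s \<le> f x}" using cellF AX by blast
    qed
  qed
  ultimately show ?thesis using that by blast
qed

end

section \<open>Controlled connectivity\<close>

text \<open>Stated for a family of subsets alone, the connectivity clauses of \<open>CC\<close>
  carry over between maps that yield the same subcomplexes.\<close>

definition connected_family :: "'x topology \<Rightarrow> nat \<Rightarrow> (real \<Rightarrow> 'x set) \<Rightarrow> bool" where
  "connected_family X n Z \<longleftrightarrow> (\<forall>s. Z s \<noteq> {}) \<and>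
     (\<forall>s. \<forall>p<n. \<exists>l\<ge>0. \<forall>f. continuous_map (nsphere p) (subtopology X (Z s)) f \<longrightarrow>
        (\<exists>F. continuous_map (disc (Suc p)) (subtopology X (Z (s - l))) F \<and>
             (\<forall>x\<in>topspace (nsphere p). F x = f x)))"

lemma CC_iff_connected_family:
  "CC (TYPE('x)) n G \<rho> e \<longleftrightarrow>
     (\<exists>(X::'x topology) cells \<alpha> h \<gamma>.
        F_complex n G X cells \<alpha> \<and> continuous_map X euclidean h \<and>
        (\<forall>g\<in>carrier G. \<forall>x\<in>topspace X. h (\<alpha> g x) = \<rho> g (h x)) \<and> \<gamma> \<in> e \<and>
        connected_family X n (\<lambda>s. largest_subcomplex X cells (h -` horoball \<gamma> s \<inter> topspace X)))"
  by (simp only: CC_def connected_family_def Let_def)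

text \<open>The lag \<open>l\<close> becomes \<open>l / r\<close>. This accounts for the positive
  factor between two representatives of a character class.\<close>

lemma connected_family_rescale:
  assumes "connected_family X n Z" "r > 0"
  shows "connected_family X n (\<lambda>s. Z (r * s))"
  unfolding connected_family_def
proof (intro conjI allI impI)
  show "Z (r * s) \<noteq> {}" for s using assms(1) by (simp add: connected_family_def)
  fix s p assume "p < n"
  then obtain l where l: "l \<ge> 0" "\<forall>f. continuous_map (nsphere p) (subtopology X (Z (r * s))) f \<longrightarrow>
        (\<exists>F. continuous_map (disc (Suc p)) (subtopology X (Z (r * s - l))) F \<and>
             (\<forall>x\<in>topspace (nsphere p). F x = f x))"
    using assms(1) unfolding connected_family_def by blast
  have "r * (s - l / r) = r * s - l" using assms(2) by (simp add: field_simps)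
  then show "\<exists>l\<ge>0. \<forall>f. continuous_map (nsphere p) (subtopology X (Z (r * s))) f \<longrightarrow>
        (\<exists>F. continuous_map (disc (Suc p)) (subtopology X (Z (r * (s - l)))) F \<and>
             (\<forall>x\<in>topspace (nsphere p). F x = f x))"
    using l assms(2) by (intro exI[of _ "l / r"]) simp
qed

text \<open>An invariant function takes finitely many values on the \<open>0\<close>-cells, and every non-empty
  subcomplex contains a \<open>0\<close>-cell.\<close>

lemma no_invariant_height:
  assumes FX: "F_complex n G X cells \<alpha>" and G: "group G"
    and inv: "\<And>g x. g \<in> carrier G \<Longrightarrow> x \<in> topspace X \<Longrightarrow> h (\<alpha> g x) = h x"
  shows "\<exists>s::real. largest_subcomplex X cells {x \<in> topspace X. s \<le> h x} = {}"
proof -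
  have gcw: "G_cw_complex G X cells \<alpha>" and fin: "finite (orbits G (cells 0) (\<lambda>g c. \<alpha> g ` c))"
    using FX by (auto simp: F_complex_def)
  have cw: "cw_complex X cells" and act: "group_action G (topspace X) \<alpha>"
    using gcw by (auto simp: G_cw_complex_def)
  have one: "\<one>\<^bsub>G\<^esub> \<in> carrier G" using G by (simp add: group.is_monoid monoid.one_closed)
  have cX: "x \<in> topspace X" if "c \<in> cells 0" "x \<in> c" for c x
    using that cw_complexD(2)[OF cw] by blast
  have "\<exists>v. \<forall>c\<in>S. \<forall>x\<in>c. h x = v" if S: "S \<in> orbits G (cells 0) (\<lambda>g c. \<alpha> g ` c)" for S
  proof -
    obtain c where c: "c \<in> cells 0" "S = orbit G (\<lambda>g c. \<alpha> g ` c) c" using S by (auto simp: orbits_def)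
    obtain \<Phi> where \<Phi>: "\<Phi> ` {x \<in> topspace (disc 0). (\<Sum>i<0. (x i)\<^sup>2) < 1} = c"
      by (rule cw_characteristic_map[OF cw c(1)]) (rule that, assumption)
    \<comment> \<open>\<open>disc 0\<close> is a point, hence so is each 0-cell, and an invariant
      function is constant on an orbit of 0-cells.\<close>
    have "{x \<in> topspace (disc 0). (\<Sum>i<0. (x i)\<^sup>2) < 1} = {\<lambda>_. 0}" by (auto simp: topspace_disc)
    then have x0: "c = {\<Phi> (\<lambda>_. 0)}" using \<Phi> by simp
    have "h x = h (\<Phi> (\<lambda>_. 0))" if "d \<in> S" "x \<in> d" for d x
    proof -
      obtain g where "g \<in> carrier G" "x = \<alpha> g (\<Phi> (\<lambda>_. 0))"
        using \<open>d \<in> S\<close> \<open>x \<in> d\<close> c(2) x0 by (auto simp: orbit_def)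
      then show ?thesis using inv cX[OF c(1)] x0 by simp
    qed
    then show ?thesis by blast
  qed
  then obtain v where v: "\<And>S c x. S \<in> orbits G (cells 0) (\<lambda>g c. \<alpha> g ` c) \<Longrightarrow> c \<in> S \<Longrightarrow> x \<in> c \<Longrightarrow> h x = v S"
    by metis
  have "bdd_above (v ` orbits G (cells 0) (\<lambda>g c. \<alpha> g ` c))" using fin by simp
  then obtain s where s: "\<And>S. S \<in> orbits G (cells 0) (\<lambda>g c. \<alpha> g ` c) \<Longrightarrow> v S \<le> s"
    by (auto simp: bdd_above_def)
  have bound: "h x \<le> s" if c: "c \<in> cells 0" and x: "x \<in> c" for c x
  proof -
    let ?S = "orbit G (\<lambda>g c. \<alpha> g ` c) c"
    have S: "?S \<in> orbits G (cells 0) (\<lambda>g c. \<alpha> g ` c)" using c by (auto simp: orbits_def)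
    have "\<alpha> \<one>\<^bsub>G\<^esub> x = x"
      using group_action.id_eq_one[OF act] cX[OF c x] by (metis restrict_apply)
    then have "x \<in> \<alpha> \<one>\<^bsub>G\<^esub> ` c" using x by (metis imageI)
    moreover have "\<alpha> \<one>\<^bsub>G\<^esub> ` c \<in> ?S" using one by (auto simp: orbit_def)
    ultimately show ?thesis using v[OF S] s[OF S] by metis
  qed
  have "A = {}" if A: "subcomplex X cells A" "A \<subseteq> {x \<in> topspace X. s + 1 \<le> h x}" for A
  proof (rule ccontr)
    assume "A \<noteq> {}"
    then obtain c where c: "c \<in> cells 0" "c \<subseteq> A" using subcomplex_contains_0_cell[OF cw A(1)] by blast
    obtain x where x: "x \<in> c" using cw_cell_nonempty[OF cw c(1)] by blast
    then have "s + 1 \<le> h x" using c(2) A(2) by blast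
    then show False using bound[OF c(1) x] by simp
  qed
  then have "largest_subcomplex X cells {x \<in> topspace X. s + 1 \<le> h x} = {}"
    unfolding largest_subcomplex_def by blast
  then show ?thesis ..
qed

section \<open>Passage between \<open>M\<close> and the line\<close>

lemma Sigma_action_imp_Sigma_group:
  fixes \<rho> :: "'g \<Rightarrow> 'm::metric_space \<Rightarrow> 'm"
  assumes G: "group G" and C0: "CAT0 TYPE('m)" and e: "e \<in> boundary" and iso: "isometric_action G \<rho>"
    and fixed: "\<forall>g\<in>carrier G. boundary_map (\<rho> g) e = e" and CC: "CC TYPE('x) n G \<rho> e"
  shows "character_class G (induced_character \<rho> e) \<in> Sigma_group TYPE('x) n G"
proof -
  let ?\<chi> = "induced_character \<rho> e"
  obtain X :: "'x topology" and cells \<alpha> h \<gamma> where X: "F_complex n G X cells \<alpha>"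
    and h: "continuous_map X euclidean h" "\<And>g x. g \<in> carrier G \<Longrightarrow> x \<in> topspace X \<Longrightarrow> h (\<alpha> g x) = \<rho> g (h x)"
    and \<gamma>: "\<gamma> \<in> e"
    and conn: "connected_family X n (\<lambda>s. largest_subcomplex X cells (h -` horoball \<gamma> s \<inter> topspace X))"
    using CC unfolding CC_iff_connected_family by blast
  let ?h = "\<lambda>x. busemann \<gamma> (h x)"
  have act: "?h (\<alpha> g x) = ?h x + ?\<chi> g" if "g \<in> carrier G" "x \<in> topspace X" for g x
    using h(2)[OF that] busemann_action[OF G C0 e iso fixed \<gamma> that(1)] by simp
  have cont: "continuous_map X euclideanreal ?h"
  proof -
    have "continuous_map euclidean euclideanreal (busemann \<gamma>)"
      using continuous_on_busemann[OF boundaryD(1)[OF e \<gamma>]] by simp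
    from continuous_map_compose[OF h(1) this] show ?thesis by (simp only: o_def)
  qed
  have nz: "?\<chi> \<in> nonzero_characters G"
  proof (rule ccontr)
    assume "?\<chi> \<notin> nonzero_characters G"
    then have "?\<chi> g = 0" if "g \<in> carrier G" for g
      using that induced_character_mult[OF G C0 e iso fixed] by (auto simp: nonzero_characters_def)
    then obtain s where "largest_subcomplex X cells {x \<in> topspace X. s \<le> ?h x} = {}"
      using no_invariant_height[OF X G, of ?h] act by auto
    moreover have "{x \<in> topspace X. s \<le> ?h x} = h -` horoball \<gamma> s \<inter> topspace X" by (auto simp: horoball_def)
    ultimately show False using conn by (simp add: connected_family_def)
  qed
  \<comment> \<open>The Busemann function of the identity ray is the identity, so the two preimages
    coincide.\<close>
  have hb: "?h -` horoball (\<lambda>t. t) s \<inter> topspace X = h -` horoball \<gamma> s \<inter> topspace X" for s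
    by (auto simp: horoball_def busemann_real_line[OF endpoint_real_line(2)])
  have "CC TYPE('x) n G (\<lambda>g r. r + ?\<chi> g) (endpoint (\<lambda>t. t))"
    unfolding CC_iff_connected_family
    by (rule exI[of _ X], rule exI[of _ cells], rule exI[of _ \<alpha>], rule exI[of _ ?h], rule exI[of _ "\<lambda>t. t"])
      (use X cont act conn in \<open>simp add: hb endpoint_real_line(2)\<close>)
  moreover have "?\<chi> \<in> character_class G ?\<chi>"
    using nz by (auto simp: character_class_def intro: exI[of _ 1])
  ultimately show ?thesis using nz unfolding Sigma_group_def character_sphere_def by blast
qed

text \<open>The ray only supplies large heights. Iterating an element of negative character, either
  \<open>g\<close> or its inverse, carries a point arbitrarily low.\<close>

lemma busemann_unbounded_below:
  fixes \<rho> :: "'g \<Rightarrow> 'm::metric_space \<Rightarrow> 'm"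
  assumes G: "group G" and C0: "CAT0 TYPE('m)" and e: "e \<in> boundary" and iso: "isometric_action G \<rho>"
    and fixed: "\<forall>g\<in>carrier G. boundary_map (\<rho> g) e = e" and \<gamma>: "\<gamma> \<in> e"
    and g: "g \<in> carrier G" "induced_character \<rho> e g \<noteq> 0"
  shows "\<exists>q. busemann \<gamma> q \<le> v"
proof -
  interpret group G by (rule G)
  note act = busemann_action[OF G C0 e iso fixed \<gamma>]
  have "\<exists>k\<in>carrier G. induced_character \<rho> e k < 0"
  proof (cases "induced_character \<rho> e g < 0")
    case False
    have "induced_character \<rho> e \<one>\<^bsub>G\<^esub> = 0"
      using act[OF one_closed, of undefined] by (simp add: isometric_actionD(3)[OF iso])
    then have "induced_character \<rho> e (inv\<^bsub>G\<^esub> g) = - induced_character \<rho> e g"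
      using induced_character_mult[OF G C0 e iso fixed g(1) inv_closed[OF g(1)]] g(1) by simp
    then show ?thesis using False g by (intro bexI[of _ "inv\<^bsub>G\<^esub> g"]) auto
  qed (use g in blast)
  then obtain k where k: "k \<in> carrier G" "induced_character \<rho> e k < 0" by blast
  have "\<exists>q. busemann \<gamma> q = busemann \<gamma> undefined + real j * induced_character \<rho> e k" for j
  proof (induction j)
    case (Suc j)
    then obtain q where "busemann \<gamma> q = busemann \<gamma> undefined + real j * induced_character \<rho> e k" by blast
    then show ?case using act[OF k(1), of q] by (intro exI[of _ "\<rho> k q"]) (simp add: algebra_simps)
  qed auto
  moreover obtain j where "busemann \<gamma> undefined - v < real j * - induced_character \<rho> e k"
    using reals_Archimedean3[of "- induced_character \<rho> e k"] k(2) by auto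
  ultimately show ?thesis by (smt (verit) mult_minus_right)
qed

lemma Sigma_group_imp_Sigma_action:
  fixes \<rho> :: "'g \<Rightarrow> 'm::metric_space \<Rightarrow> 'm"
  assumes G: "group G" and C0: "CAT0 TYPE('m)" and e: "e \<in> boundary" and iso: "isometric_action G \<rho>"
    and fixed: "\<forall>g\<in>carrier G. boundary_map (\<rho> g) e = e"
    and Sigma: "character_class G (induced_character \<rho> e) \<in> Sigma_group TYPE('x) n G"
  shows "CC TYPE('x) n G \<rho> e"
proof -
  let ?\<chi> = "induced_character \<rho> e"
  obtain \<psi> where \<psi>: "\<psi> \<in> character_class G ?\<chi>" "CC TYPE('x) n G (\<lambda>g r. r + \<psi> g) (endpoint (\<lambda>t. t))"
    using Sigma unfolding Sigma_group_def by blast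
  then obtain r where r: "r > 0" "\<And>g. g \<in> carrier G \<Longrightarrow> \<psi> g = r * ?\<chi> g"
    and nz: "\<psi> \<in> nonzero_characters G" unfolding character_class_def by blast
  obtain X :: "'x topology" and cells \<alpha> h \<gamma>' where X: "F_complex n G X cells \<alpha>"
    and h: "continuous_map X euclideanreal h" "\<And>g x. g \<in> carrier G \<Longrightarrow> x \<in> topspace X \<Longrightarrow> h (\<alpha> g x) = h x + \<psi> g"
    and \<gamma>': "\<gamma>' \<in> endpoint (\<lambda>t. t)"
    and conn: "connected_family X n (\<lambda>s. largest_subcomplex X cells (h -` horoball \<gamma>' s \<inter> topspace X))"
    using \<psi>(2) unfolding CC_iff_connected_family by blast
  obtain \<gamma> where \<gamma>: "\<gamma> \<in> e" using boundary_nonempty[OF e] .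
  obtain g where g: "g \<in> carrier G" "?\<chi> g \<noteq> 0" using nz r(2) by (auto simp: nonzero_characters_def)
  \<comment> \<open>Subtracting \<open>\<gamma>' 0\<close> gives the height with respect to
    \<open>\<gamma>'\<close>; dividing by \<open>r\<close> turns the character \<open>\<psi>\<close>
    into \<open>?\<chi>\<close>.\<close>
  define f where "f x = (h x - \<gamma>' 0) / r" for x
  have "equivariant_height G X cells \<alpha> \<rho> \<gamma> f ?\<chi>"
  proof (rule equivariant_height.intro)
    show "group G" by (rule G)
    show "G_cw_complex G X cells \<alpha>" "free_action G (topspace X) \<alpha>" using X by (simp_all add: F_complex_def)
    show "CAT0 TYPE('m)" "isometric_action G \<rho>" by fact+
    show ray: "geodesic_ray \<gamma>" using boundaryD(1)[OF e \<gamma>] .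
    show "continuous_map X euclideanreal f"
      unfolding f_def[abs_def] divide_inverse by (intro continuous_intros h(1))
    show "f (\<alpha> g x) = f x + ?\<chi> g" if "g \<in> carrier G" "x \<in> topspace X" for g x
      using h(2)[OF that] r(1) r(2)[OF that(1)] by (simp add: f_def field_simps)
    show "busemann \<gamma> (\<rho> g a) = busemann \<gamma> a + ?\<chi> g" if "g \<in> carrier G" for g a
      by (rule busemann_action[OF G C0 e iso fixed \<gamma> that])
    show "\<exists>q. busemann \<gamma> q = f x" for x
      using busemann_unbounded_below[OF G C0 e iso fixed \<gamma> g, of "f x"] busemann_surj[OF C0 ray] by blast
  qed
  then interpret equivariant_height G X cells \<alpha> \<rho> \<gamma> f ?\<chi> .
  obtain H where H: "continuous_map X euclidean H"
    "\<And>g x. g \<in> carrier G \<Longrightarrow> x \<in> topspace X \<Longrightarrow> H (\<alpha> g x) = \<rho> g (H x)"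
    "\<And>s. largest_subcomplex X cells (H -` horoball \<gamma> s \<inter> topspace X) =
      largest_subcomplex X cells {x \<in> topspace X. s \<le> f x}"
    by (rule height_preserving_map) (rule that, assumption+)
  have "{x \<in> topspace X. s \<le> f x} = h -` horoball \<gamma>' (r * s) \<inter> topspace X" for s
    using r(1) by (auto simp: horoball_def busemann_real_line[OF \<gamma>'] f_def field_simps)
  then have "connected_family X n (\<lambda>s. largest_subcomplex X cells (H -` horoball \<gamma> s \<inter> topspace X))"
    unfolding H(3) using connected_family_rescale[OF conn r(1)] by simp
  then show ?thesis
    unfolding CC_iff_connected_family using X H(1,2) \<gamma> by blast
qed

theorem theoremI:
  fixes n :: nat
    and G :: "('g, 'b) monoid_scheme"
    and \<rho> :: "'g \<Rightarrow> 'm::metric_space \<Rightarrow> 'm"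
    and e :: "(real \<Rightarrow> 'm) set"
    and b :: 'm
  assumes "group G"
    and "type_F TYPE('x) n G"
    and "proper_space TYPE('m)"
    and "CAT0 TYPE('m)"
    and "e \<in> boundary"
    and "isometric_action G \<rho>"
    and "\<forall>g\<in>carrier G. boundary_map (\<rho> g) e = e"
  shows "(e \<in> Sigma_action TYPE('x) n G \<rho> \<longleftrightarrow>
            character_class G (induced_character \<rho> e) \<in> Sigma_group TYPE('x) n G) \<and>
         (e \<in> Sigma_action_circ TYPE('x) b n G \<rho> \<longleftrightarrow>
            character_class G (induced_character \<rho> e) \<in> Sigma_group TYPE('x) n G)"
proof -
  have "e \<in> Sigma_action TYPE('x) n G \<rho> \<longleftrightarrow>
      character_class G (induced_character \<rho> e) \<in> Sigma_group TYPE('x) n G"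
    using Sigma_action_imp_Sigma_group[OF assms(1,4-7)] Sigma_group_imp_Sigma_action[OF assms(1,4-7)] assms(5)
    by (auto simp: Sigma_action_def)
  moreover have "e \<in> Sigma_action_circ TYPE('x) b n G \<rho> \<longleftrightarrow> e \<in> Sigma_action TYPE('x) n G \<rho>"
    by (rule Sigma_action_circ_fixed_point[OF assms(4,3,5,1,7)])
  ultimately show ?thesis by simp
qed

end
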